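(* Let $\mathcal{H}=([n],\mathcal{E})$ be a hypergraph in hyperfect elimination order, and let $\Pi_{\mathcal{H}}=\{\pi_h \mid h\in \mathrm{AO}_{\mathcal{H}}\}\subseteq S_n$ be the set of permutations encoding the acyclic orientations of $\mathcal{H}$ (see context). Then Algorithm J with input $\Pi_{\mathcal{H}}$ and initial permutation $\mathrm{id}_n$ generates a sequence of permutations $\pi_{h_1},\pi_{h_2},\ldots$ with $h_1,h_2,\ldots\in \mathrm{AO}_{\mathcal{H}}$ such that $h_1,h_2,\ldots$ is a Hamilton path in the flip graph on acyclic orientations of $\mathcal{H}$, or equivalently (via the identification of $h$ with the vertex $\delta_{\mathcal{H},h}$), a Hamilton path on the skeleton of the hypergraphic polytope $Z(\mathcal{H})$.
   Context: Hypergraphs. $[n]=\{1,\ldots,n\}$. A hypergraph $\mathcal{H}=([n],\mathcal{E})$ has $\mathcal{E}\subseteq 2^{[n]}$ with all hyperedges nonempty. For $i\le n$, $\mathcal{H}_i$ is the subgraph induced by $[i]$, i.e. the hypergraph on $[i]$ whose hyperedges are those $A\in\mathcal{E}$ with $A\subseteq[i]$. $X-n$ means $X\setminus\{n\}$. Hyperfect elimination order. $\mathcal{H}=([n],\mathcal{E})$ is in hyperfect elimination order if either $n=0$, or $n\ge1$ and: (i) for any two (not necessarily distinct) hyperedges $A,B\in\mathcal{E}$ with $n\in A\cap B$ and any two distinct vertices $a\in A-n$, $b\in B-n$ there is $X\in\mathcal{E}$ with $\{a,b\}\subseteq X\subseteq (A\cup B)-n$; and (ii) $\mathcal{H}_{n-1}$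 is in hyperfect elimination order. Orientations. An orientation of $\mathcal{H}$ is a map $h:\mathcal{E}\to[n]$ with $h(A)\in A$ for all $A\in\mathcal{E}$. It is acyclic if the digraph on $[n]$ with an arc $i\to j$ for all distinct $i,j$ such that $i,j\in A$ and $j=h(A)$ for some $A\in\mathcal{E}$ is acyclic. $\mathrm{AO}_{\mathcal{H}}$ is the set of acyclic orientations. For $h\in\mathrm{AO}_{\mathcal{H}}$, $P_{\mathcal{H},h}$ is the poset on $[n]$ given by the transitive closure of: $i\prec j$ if $i\ne j$ and there is $A\in\mathcal{E}$ with $i,j\in A$ and $j=h(A)$. Flip graph. A pair flip of a pair $(i,j)$ of distinct vertices maps an orientation $h$ to the orientation $h'$ with $h'(A)=i$ if $h(A)=j$ and $i\in A$, and $h'(A)=h(A)$ otherwise, where $h'\neq h$ is required. The flip graph on $\mathrm{AO}_{\mathcal{H}}$ joins two acyclic orientations by an edge iff they differ in a pair flip. Hypergraphic polytope. $Z(\mathcal{H})=\sum_{A\in\mathcal{E}}\Delta_A$ (Minkowski sum), where $\Delta_A=\mathrm{conv}\{e_i\mid i\in A\}\subseteq\mathbb{R}^n$. Its vertices are the in-degree sequences $\delta_{\mathcal{H},h}=(d^-(1),\ldots,d^-(n))$, $d^-(i)=|\{A\in\mathcal{E}\mid h(A)=i\}|$, for $h\in \mathrm{AO}_{\mathcal{H}}$, and it is known that $h\mapsto\delta_{\mathcal{H},h}$ is an isomorphism from the flip graph on $\mathrm{AO}_{\mathcal{H}}$ to the skeleton (graph of vertices and edges) of $Z(\mathcal{H})$.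 Permutations. $S_n$ is the set of permutations of $[n]$ written as words $a_1\cdots a_n$, $\mathrm{id}_n=12\cdots n$, $\varepsilon$ is the empty permutation. For $\pi\in S_{n-1}$ and $1\le i\le n$, $c_i(\pi)\in S_n$ is obtained from $\pi$ by inserting the value $n$ at position $i$. Encoding. For $\mathcal{H}$ in hyperfect elimination order and $h\in\mathrm{AO}_{\mathcal{H}}$ let $h_{n-1}$ be the restriction of $h$ to $\mathcal{H}_{n-1}$. Define $\pi_h\in S_n$ by $\pi_h:=\varepsilon$ if $n=0$, and for $n\ge1$: (i) if $n$ is maximal in $P_{\mathcal{H},h}$, then $\pi_h:=c_n(\pi_{h_{n-1}})$; (ii) else if $n$ is minimal in $P_{\mathcal{H},h}$, then $\pi_h:=c_1(\pi_{h_{n-1}})$; (iii) otherwise $\pi_h:=c_i(\pi_{h_{n-1}})$, where $i$ is the position in $\pi_{h_{n-1}}$ of the (unique) vertex that covers $n$ in $P_{\mathcal{H},h}$. The map $h\mapsto\pi_h$ is injective. Jumps. Given $\pi=a_1\cdots a_n$ with a substring $a_i\cdots a_{i+d}$, $d>0$, $a_i>a_{i+1},\ldots,a_{i+d}$, a right jump of the value $a_i$ by $d$ steps replaces this substring by $a_{i+1}\cdots a_{i+d}a_i$. Given a substring $a_{i-d}\cdots a_i$, $d>0$, $a_i>a_{i-d},\ldots,a_{i-1}$, a left jump of $a_i$ by $d$ steps replaces it by $a_ia_{i-d}\cdots a_{i-1}$. A jump is minimal with respect to $L_n\subseteq S_n$ if every jump of the same value in the same direction by fewer steps creates a permutation not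 in $L_n$. Algorithm J (input $L_n\subseteq S_n$, initial permutation $\pi_0\in L_n$). J1: Visit $\pi_0$. J2: Generate an unvisited permutation from $L_n$ by performing a minimal jump of the largest possible value in the most recently visited permutation. If no such jump exists, or the jump direction is ambiguous, terminate. Otherwise visit this permutation and repeat J2. *)

theory Defs
  imports "HOL-Analysis.Analysis" "HOL-Analysis.Finite_Function_Topology" "HOL-Library.Set_Algebras" "HOL-Library.FuncSet"
begin

section \<open>Hypergraphs in hyperfect elimination order\<close>

text \<open>A hypergraph on \<open>{1..n}\<close> is given by the number \<open>n\<close> and its set \<open>E\<close> of hyperedges.\<close>

definition hypergraph :: "nat \<Rightarrow> nat set set \<Rightarrow> bool" where
  "hypergraph n E \<longleftrightarrow> E \<subseteq> Pow {1..n} \<and> {} \<notin> E"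

definition induced :: "nat set set \<Rightarrow> nat \<Rightarrow> nat set set" where
  "induced E i = {A \<in> E. A \<subseteq> {1..i}}"

fun hyperfect :: "nat \<Rightarrow> nat set set \<Rightarrow> bool" where
  "hyperfect 0 E \<longleftrightarrow> True"
| "hyperfect (Suc n) E \<longleftrightarrow>
     (\<forall>A\<in>E. \<forall>B\<in>E. Suc n \<in> A \<inter> B \<longrightarrow>
        (\<forall>a \<in> A - {Suc n}. \<forall>b \<in> B - {Suc n}. a \<noteq> b \<longrightarrow>
           (\<exists>X\<in>E. {a, b} \<subseteq> X \<and> X \<subseteq> (A \<union> B) - {Suc n}))) \<and>
     hyperfect n (induced E n)"


section \<open>Acyclic orientations and their posets\<close>

text \<open>Orientations are extensional functions on \<open>E\<close>, so that equality of functions is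
  equality of orientations.\<close>

definition orientations :: "nat set set \<Rightarrow> (nat set \<Rightarrow> nat) set" where
  "orientations E = (\<Pi>\<^sub>E A\<in>E. A)"

definition arcs :: "nat set set \<Rightarrow> (nat set \<Rightarrow> nat) \<Rightarrow> (nat \<times> nat) set" where
  "arcs E h = {(i, j). i \<noteq> j \<and> (\<exists>A\<in>E. i \<in> A \<and> j \<in> A \<and> j = h A)}"

definition acyclic_orientations :: "nat set set \<Rightarrow> (nat set \<Rightarrow> nat) set" where
  "acyclic_orientations E = {h \<in> orientations E. acyclic (arcs E h)}"

text \<open>The strict order of the poset of an acyclic orientation.\<close>

definition precedes :: "nat set set \<Rightarrow> (nat set \<Rightarrow> nat) \<Rightarrow> nat \<Rightarrow> nat \<Rightarrow> bool" where
  "precedes E h i j \<longleftrightarrow> (i, j) \<in> (arcs E h)\<^sup>+"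

definition covered_by :: "nat set set \<Rightarrow> (nat set \<Rightarrow> nat) \<Rightarrow> nat \<Rightarrow> nat \<Rightarrow> bool" where
  "covered_by E h i j \<longleftrightarrow>
     precedes E h i j \<and> (\<nexists>k. precedes E h i k \<and> precedes E h k j)"


section \<open>Graphs and Hamilton paths\<close>

text \<open>A graph consists of a vertex set \<open>V\<close> and a set \<open>F\<close> of two-element sets of vertices.\<close>

definition hamilton_path :: "'a set \<times> 'a set set \<Rightarrow> 'a list \<Rightarrow> bool" where
  "hamilton_path = (\<lambda>(V, F) xs.
     distinct xs \<and> set xs = V \<and> successively (\<lambda>x y. {x, y} \<in> F) xs)"

definition pair_flip ::
  "nat \<Rightarrow> nat set set \<Rightarrow> (nat set \<Rightarrow> nat) \<Rightarrow> (nat set \<Rightarrow> nat) \<Rightarrow> bool" where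
  "pair_flip n E h h' \<longleftrightarrow>
     (\<exists>i\<in>{1..n}. \<exists>j\<in>{1..n}. i \<noteq> j \<and>
        h' = (\<lambda>A\<in>E. if h A = j \<and> i \<in> A then i else h A)) \<and> h' \<noteq> h"

definition flip_graph ::
  "nat \<Rightarrow> nat set set \<Rightarrow> (nat set \<Rightarrow> nat) set \<times> (nat set \<Rightarrow> nat) set set" where
  "flip_graph n E =
     (acyclic_orientations E,
      {{h, h'} | h h'. h \<in> acyclic_orientations E \<and> h' \<in> acyclic_orientations E \<and>
                       pair_flip n E h h'})"


section \<open>Hypergraphic polytopes\<close>

text \<open>Since \<open>n\<close> is a variable (possibly \<open>0\<close>), \<open>\<real>\<^sup>n\<close> is taken to be the coordinate subspace of
  vectors supported on \<open>{1..n}\<close> in the real vector space of finitely supported functions on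
  \<open>nat\<close>. Convex hulls, faces and extreme points do not depend on the ambient space.\<close>

definition unit_vec :: "nat \<Rightarrow> nat \<Rightarrow>\<^sub>0 real" where
  "unit_vec i = Poly_Mapping.single i 1"

definition hypergraphic_polytope :: "nat set set \<Rightarrow> (nat \<Rightarrow>\<^sub>0 real) set" where
  "hypergraphic_polytope E = (\<Sum>A\<in>E. convex hull (unit_vec ` A))"

definition indegree :: "nat set set \<Rightarrow> (nat set \<Rightarrow> nat) \<Rightarrow> nat \<Rightarrow> nat" where
  "indegree E h i = card {A \<in> E. h A = i}"

definition indegree_vec :: "nat \<Rightarrow> nat set set \<Rightarrow> (nat set \<Rightarrow> nat) \<Rightarrow> nat \<Rightarrow>\<^sub>0 real" where
  "indegree_vec n E h = (\<Sum>i\<in>{1..n}. real (indegree E h i) *\<^sub>R unit_vec i)"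

text \<open>The one-dimensional faces of a polytope are its faces of the form \<open>closed_segment u v\<close>
  with \<open>u \<noteq> v\<close>; the library's \<^const>\<open>edge_of\<close> is restricted to Euclidean spaces.\<close>

definition skeleton :: "'a::real_vector set \<Rightarrow> 'a set \<times> 'a set set" where
  "skeleton Z =
     ({v. v extreme_point_of Z}, {{u, v} | u v. u \<noteq> v \<and> closed_segment u v face_of Z})"


section \<open>Encoding acyclic orientations by permutations\<close>

text \<open>Permutations of \<open>{1..n}\<close> are words, i.e. lists; positions are counted from \<open>1\<close>.\<close>

definition insert_max :: "nat \<Rightarrow> nat list \<Rightarrow> nat list" where
  "insert_max i p = take (i - 1) p @ [Suc (length p)] @ drop (i - 1) p"

definition position :: "nat list \<Rightarrow> nat \<Rightarrow> nat" where
  "position p v = (THE i. 1 \<le> i \<and> i \<le> length p \<and> p ! (i - 1) = v)"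

fun encode :: "nat \<Rightarrow> nat set set \<Rightarrow> (nat set \<Rightarrow> nat) \<Rightarrow> nat list" where
  "encode 0 E h = []"
| "encode (Suc n) E h =
     (let p = encode n (induced E n) (restrict h (induced E n)) in
      if \<nexists>j. precedes E h (Suc n) j then insert_max (Suc n) p
      else if \<nexists>j. precedes E h j (Suc n) then insert_max 1 p
      else insert_max (position p (THE j. covered_by E h (Suc n) j)) p)"

definition encodings :: "nat \<Rightarrow> nat set set \<Rightarrow> nat list set" where
  "encodings n E = encode n E ` acyclic_orientations E"

definition id_perm :: "nat \<Rightarrow> nat list" where
  "id_perm n = [1..<Suc n]"


section \<open>Algorithm J\<close>

datatype direction = Leftward | Rightward

fun jump :: "direction \<Rightarrow> nat \<Rightarrow> nat \<Rightarrow> nat list \<Rightarrow> nat list \<Rightarrow> bool" where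
  "jump Rightward v d p q \<longleftrightarrow>
     (\<exists>xs ys zs. p = xs @ [v] @ ys @ zs \<and> q = xs @ ys @ [v] @ zs \<and>
        length ys = d \<and> d > 0 \<and> (\<forall>y\<in>set ys. y < v))"
| "jump Leftward v d p q \<longleftrightarrow>
     (\<exists>xs ys zs. p = xs @ ys @ [v] @ zs \<and> q = xs @ [v] @ ys @ zs \<and>
        length ys = d \<and> d > 0 \<and> (\<forall>y\<in>set ys. y < v))"

definition minimal_jump ::
  "nat list set \<Rightarrow> direction \<Rightarrow> nat \<Rightarrow> nat list \<Rightarrow> nat list \<Rightarrow> bool" where
  "minimal_jump L dir v p q \<longleftrightarrow>
     (\<exists>d. jump dir v d p q \<and> (\<forall>d' q'. d' < d \<longrightarrow> jump dir v d' p q' \<longrightarrow> q' \<notin> L))"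

text \<open>\<open>ps\<close> is the sequence of permutations visited so far. In \<open>J_step\<close>, the last conjunct says
  that the direction of the jump is unambiguous.\<close>

definition J_candidate ::
  "nat list set \<Rightarrow> nat list list \<Rightarrow> direction \<Rightarrow> nat \<Rightarrow> nat list \<Rightarrow> bool" where
  "J_candidate L ps dir v q \<longleftrightarrow> minimal_jump L dir v (last ps) q \<and> q \<in> L \<and> q \<notin> set ps"

definition J_step :: "nat list set \<Rightarrow> nat list list \<Rightarrow> nat list \<Rightarrow> bool" where
  "J_step L ps q \<longleftrightarrow>
     (\<exists>dir v. J_candidate L ps dir v q \<and>
        (\<forall>dir' v' q'. J_candidate L ps dir' v' q' \<longrightarrow> v' \<le> v) \<and>
        (\<forall>dir' q'. J_candidate L ps dir' v q' \<longrightarrow> dir' = dir))"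

inductive J_visits :: "nat list set \<Rightarrow> nat list \<Rightarrow> nat list list \<Rightarrow> bool"
  for L p where
  start: "J_visits L p [p]"
| step: "J_visits L p ps \<Longrightarrow> J_step L ps q \<Longrightarrow> J_visits L p (ps @ [q])"

text \<open>\<open>ps\<close> is the complete sequence of permutations visited by a terminated run.\<close>

definition J_output :: "nat list set \<Rightarrow> nat list \<Rightarrow> nat list list \<Rightarrow> bool" where
  "J_output L p ps \<longleftrightarrow> J_visits L p ps \<and> (\<nexists>q. J_step L ps q)"

end

theory Submission
  imports Defs
begin

text \<open>
  Let \<open>N = n + 1\<close>, let \<open>h'\<close> be an acyclic orientation of the subgraph induced by \<open>{1..n}\<close>, and call
  the maximum of \<open>A - N\<close> in the poset of \<open>h'\<close> the peak of a hyperedge \<open>A\<close> containing \<open>N\<close>; it exists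
  because of hyperfectness. Again by hyperfectness the distinct peaks form a chain
  \<open>c\<^sub>1 \<prec> \<dots> \<prec> c\<^sub>k\<close>, and the acyclic orientations extending \<open>h'\<close> are exactly those that, for some
  \<open>i \<le> k\<close>, orient the hyperedges at \<open>N\<close> with a peak among \<open>c\<^sub>1, \<dots>, c\<^sub>i\<close> towards \<open>N\<close> and all others
  towards their peak. Since every encoding is a linear extension of its poset, increasing \<open>i\<close> by one
  is a pair flip that moves \<open>N\<close> to the right in the encoding, from the very left to the very right.
  Algorithm J therefore sweeps \<open>N\<close> alternately to the left and to the right, and between two sweeps
  it performs a step for the induced subgraph while \<open>N\<close> is minimal or maximal.

  For the polytope, the in-degree vector of an acyclic orientation is the unique maximizer of a
  linear functional that increases along the poset, and a pair flip of \<open>(i, j)\<close> is an edge because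
  the poset remains acyclic when \<open>i\<close> and \<open>j\<close> are identified.
\<close>

section \<open>Algorithm J\<close>

text \<open>Two points shape the induction. Algorithm J chooses among the jumps of all values, so a
  Hamilton path alone is not enough: every step must be forced. During a sweep the unvisited places
  of \<open>N\<close> over the current word lie on one side of \<open>N\<close>, so \<open>N\<close>
  has a candidate jump in exactly one direction. When the sweep is over, \<open>N\<close> has none,
  and since it then stands at an end of the word, the jumps of smaller letters are exactly those of
  the shorter word. Second, two consecutive sweeps belong to orientations of the smaller hypergraph
  that differ in a flip, and this flip has to lift at the end where the sweeps meet. With
  \<open>N\<close> maximal this is immediate. With \<open>N\<close> minimal every hyperedge at
  \<open>N\<close> points to its peak, and the lift rests on the fact that peaks change under a flip
  by the same rule as heads. A vertex \<open>N\<close> that lies in no hyperedge except possibly the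
  singleton is both minimal and maximal; its only place is the right end, and each sweep is then a
  single word.\<close>

text \<open>The successive steps are forced, and the algorithm stops at the end of \<open>qs\<close>.\<close>

definition J_run :: "nat list set \<Rightarrow> nat list list \<Rightarrow> bool" where
  "J_run L qs \<longleftrightarrow>
     (\<forall>xs ys q. qs = xs @ ys \<longrightarrow> xs \<noteq> [] \<longrightarrow> (J_step L xs q \<longleftrightarrow> (\<exists>zs. ys = q # zs)))"

lemma J_runD:
  assumes "J_run L (xs @ ys)" "xs \<noteq> []"
  shows "J_step L xs q \<longleftrightarrow> (\<exists>zs. ys = q # zs)"
  using assms unfolding J_run_def by blast

text \<open>A sequence of visits can only be a nonempty prefix of the forced list, and each such
  prefix is reached. A proper prefix still has a successor, so termination happens exactly at the
  full list; the equivalence contains both existence and uniqueness of the terminated run.\<close>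

lemma J_output_iff_run:
  assumes "J_run L (p # qs)"
  shows "J_output L p ps \<longleftrightarrow> ps = p # qs"
proof -
  have prefix: "ps \<noteq> [] \<and> (\<exists>ys. p # qs = ps @ ys)" if "J_visits L p ps" for ps
    using that
  proof induction
    case (step ps q)
    then obtain ys where "p # qs = ps @ ys" "ps \<noteq> []" by blast
    with assms step.hyps(2) obtain zs where "ys = q # zs"
      using J_runD[of L ps ys q] by auto
    with \<open>p # qs = ps @ ys\<close> show ?case by simp
  qed simp
  have visits: "J_visits L p ps" if "p # qs = ps @ ys" "ps \<noteq> []" for ps ys
    using that
  proof (induction ps arbitrary: ys rule: rev_induct)
    case (snoc q ps)
    show ?case
    proof (cases "ps = []")
      case True
      with snoc.prems show ?thesis by (simp add: J_visits.start)
    next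
      case False
      with snoc have "J_visits L p ps" by simp
      moreover have "J_step L ps q"
        using assms J_runD[of L ps "q # ys" q] snoc.prems False by simp
      ultimately show ?thesis by (rule J_visits.step)
    qed
  qed simp
  show ?thesis
  proof
    assume out: "J_output L p ps"
    then obtain ys where ys: "p # qs = ps @ ys" "ps \<noteq> []"
      using prefix unfolding J_output_def by blast
    have "ys = []"
    proof (cases ys)
      case (Cons q zs)
      then have "J_step L ps q"
        using assms J_runD[of L ps ys q] ys by simp
      with out show ?thesis unfolding J_output_def by blast
    qed
    with ys show "ps = p # qs" by simp
  next
    assume "ps = p # qs"
    with visits[of ps "[]"] assms J_runD[of L ps "[]"] show "J_output L p ps"
      unfolding J_output_def by simp
  qed
qed

section \<open>Concatenating sweeps in alternating directions\<close>

fun zigzag :: "bool \<Rightarrow> ('a \<Rightarrow> 'b list) \<Rightarrow> 'a list \<Rightarrow> 'b list" where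
  "zigzag b f [] = []"
| "zigzag b f (x # xs) = (if b then rev (f x) else f x) @ zigzag (\<not> b) f xs"

lemma set_zigzag [simp]: "set (zigzag b f xs) = (\<Union>x\<in>set xs. set (f x))"
  by (induction xs arbitrary: b) auto

lemma map_zigzag: "map g (zigzag b f xs) = zigzag b (\<lambda>x. map g (f x)) xs"
  by (induction xs arbitrary: b) (auto simp: rev_map)

lemma zigzag_cong: "(\<And>x. x \<in> set xs \<Longrightarrow> f x = g x) \<Longrightarrow> zigzag b f xs = zigzag b g xs"
  by (induction xs arbitrary: b) auto

lemma distinct_zigzag:
  assumes "distinct xs" "\<And>x. x \<in> set xs \<Longrightarrow> distinct (f x)"
    and "\<And>x y. x \<in> set xs \<Longrightarrow> y \<in> set xs \<Longrightarrow> x \<noteq> y \<Longrightarrow> set (f x) \<inter> set (f y) = {}"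
  shows "distinct (zigzag b f xs)"
  using assms
proof (induction xs arbitrary: b)
  case (Cons x xs)
  have "distinct (zigzag (\<not> b) f xs)"
    by (rule Cons.IH) (use Cons.prems in auto)
  moreover have "set (f x) \<inter> (\<Union>y\<in>set xs. set (f y)) = {}"
    using Cons.prems(1) Cons.prems(3)[of x] by fastforce
  ultimately show ?case using Cons.prems(2)[of x] by auto
qed simp

text \<open>The flag of \<open>zigzag\<close> says whether the current block is reversed. A reversed
  block ends in its original head and is followed by a block starting with its head; a forward block
  meets the next one at the last elements. This is why both ends are compared, and symmetry of
  \<open>R\<close> pays for the reversal.\<close>

lemma successively_zigzag:
  assumes "\<And>x y. R x y \<Longrightarrow> R y x"
    and "\<And>x. x \<in> set xs \<Longrightarrow> f x \<noteq> [] \<and> successively R (f x)"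
    and "successively (\<lambda>x y. R (hd (f x)) (hd (f y)) \<and> R (last (f x)) (last (f y))) xs"
  shows "successively R (zigzag b f xs)"
  using assms(2,3)
proof (induction xs arbitrary: b)
  case (Cons x xs)
  have "successively R (rev (f x))"
    using Cons.prems(1)[of x] assms(1) by (auto intro: successively_mono)
  moreover have "successively R (zigzag (\<not> b) f xs)"
    using Cons by (auto simp: successively_Cons)
  ultimately show ?case
    using Cons.prems
    by (cases xs) (auto simp: successively_append_iff hd_rev last_rev successively_Cons)
qed simp

text \<open>Locates the most recent visit: it is the last element of \<open>f1\<close>, inside the
  block of \<open>x\<close>, and \<open>c\<close> is the direction of that block. Requiring
  \<open>f1\<close> to be nonempty assigns a cut between two blocks to the earlier one, so that
  \<open>f2 = []\<close> means that a sweep has just ended.\<close>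

lemma zigzag_split:
  assumes "zigzag b f xs = us @ ys" "us \<noteq> []"
  obtains xs1 x xs2 c f1 f2 where "xs = xs1 @ x # xs2" "f1 \<noteq> []"
    "(if c then rev (f x) else f x) = f1 @ f2"
    "us = zigzag b f xs1 @ f1" "ys = f2 @ zigzag (\<not> c) f xs2"
  using assms that
proof (induction xs arbitrary: b us thesis)
  case (Cons x xs)
  define B where "B = (if b then rev (f x) else f x)"
  have eq: "B @ zigzag (\<not> b) f xs = us @ ys"
    using Cons.prems(2) by (simp add: B_def)
  show ?case
  proof (cases "length us \<le> length B")
    case True
    then obtain f2 where "B = us @ f2" "ys = f2 @ zigzag (\<not> b) f xs"
      using eq by (auto simp: append_eq_append_conv2)
    then show ?thesis
      using Cons.prems(3) Cons.prems(1)[of "[]" x xs us b f2] by (simp add: B_def)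
  next
    case False
    then obtain us' where us': "us = B @ us'" "zigzag (\<not> b) f xs = us' @ ys" "us' \<noteq> []"
      using eq by (auto simp: append_eq_append_conv2)
    have key: thesis
      if "xs = xs1 @ y # xs2" "f1 \<noteq> []" "(if c then rev (f y) else f y) = f1 @ f2"
        "us' = zigzag (\<not> b) f xs1 @ f1" "ys = f2 @ zigzag (\<not> c) f xs2" for xs1 y xs2 f1 c f2
      using that us'(1) Cons.prems(1)[of "x # xs1" y xs2 f1 c f2] by (simp add: B_def)
    show ?thesis
      by (rule Cons.IH[OF _ us'(2,3)]; rule key)
  qed
qed simp

section \<open>Inserting the largest letter behind \<open>g\<close> letters, where \<open>g\<close>
  runs from 0 to \<open>n\<close> (positions run from 1), and jumping with it\<close>

abbreviation ins :: "nat \<Rightarrow> nat list \<Rightarrow> nat list" where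
  "ins g \<equiv> insert_max (Suc g)"

lemma ins_eq: "ins g p = take g p @ Suc (length p) # drop g p"
  by (simp add: insert_max_def)

lemma ins_0: "ins 0 p = Suc (length p) # p"
  by (simp add: ins_eq)

lemma ins_length: "ins (length p) p = p @ [Suc (length p)]"
  by (simp add: ins_eq)

lemma set_ins: "set (ins g p) = insert (Suc (length p)) (set p)"
proof -
  have "set (ins g p) = insert (Suc (length p)) (set (take g p @ drop g p))"
    unfolding ins_eq set_append by simp
  then show ?thesis unfolding append_take_drop_id .
qed

lemma ins_inject:
  assumes "length p = n" "length p' = n" "Suc n \<notin> set p" "Suc n \<notin> set p'" "g \<le> n" "g' \<le> n"
  shows "ins g p = ins g' p' \<longleftrightarrow> g = g' \<and> p = p'"
proof
  assume "ins g p = ins g' p'"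
  moreover have "Suc n \<notin> set (take g p)" "Suc n \<notin> set (drop g p)"
    using assms(3) by (meson in_set_takeD in_set_dropD)+
  ultimately have *: "take g p = take g' p'" "drop g p = drop g' p'"
    using append_Cons_eq_iff[of "Suc n" "take g p" "drop g p" "take g' p'" "drop g' p'"] assms(1,2)
    by (simp_all add: ins_eq)
  have "g = g'" using arg_cong[OF *(1), of length] assms by simp
  moreover have "p = p'" using * append_take_drop_id by metis
  ultimately show "g = g' \<and> p = p'" by simp
qed simp

lemma jump_max_Rightward:
  assumes "length p = n" "set p \<subseteq> {1..n}" "g \<le> n"
  shows "jump Rightward (Suc n) d (ins g p) q \<longleftrightarrow> 0 < d \<and> g + d \<le> n \<and> q = ins (g + d) p"
proof
  have notin: "Suc n \<notin> set (take g p)" "Suc n \<notin> set (drop g p)"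
    using assms(2) by (auto dest: in_set_takeD in_set_dropD)
  {
    assume "jump Rightward (Suc n) d (ins g p) q"
    then obtain xs ys zs where *: "ins g p = xs @ Suc n # ys @ zs"
      "q = xs @ ys @ Suc n # zs" "length ys = d" "d > 0" by auto
    then have eq: "xs = take g p" "ys @ zs = drop g p"
      using append_Cons_eq_iff[OF notin] assms(1) by (auto simp: ins_eq)
    have "d \<le> n - g" using arg_cong[OF eq(2), of length] *(3) assms(1) by simp
    moreover have "ys = take d (drop g p)" "zs = drop d (drop g p)"
      using *(3) by (simp_all flip: eq(2))
    ultimately show "0 < d \<and> g + d \<le> n \<and> q = ins (g + d) p"
      using *(2,4) eq(1) assms by (simp add: ins_eq take_add add.commute[of d g])
  }
  assume *: "0 < d \<and> g + d \<le> n \<and> q = ins (g + d) p"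
  have "\<forall>y\<in>set (take d (drop g p)). y < Suc n"
    using assms(2) by (auto dest!: in_set_takeD in_set_dropD)
  moreover have "take d (drop g p) @ drop (g + d) p = drop g p"
    by (metis add.commute append_take_drop_id drop_drop)
  then have "ins g p = take g p @ [Suc n] @ take d (drop g p) @ drop (g + d) p"
    using assms(1) by (simp add: ins_eq)
  moreover have "q = take g p @ take d (drop g p) @ [Suc n] @ drop (g + d) p"
    using assms(1) * by (simp add: ins_eq take_add)
  moreover have "length (take d (drop g p)) = d" using * assms(1) by (auto simp: min_def)
  ultimately show "jump Rightward (Suc n) d (ins g p) q"
    using * unfolding jump.simps by blast
qed

lemma jump_max_Leftward:
  assumes "length p = n" "set p \<subseteq> {1..n}" "g \<le> n"
  shows "jump Leftward (Suc n) d (ins g p) q \<longleftrightarrow> 0 < d \<and> d \<le> g \<and> q = ins (g - d) p"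
proof
  have notin: "Suc n \<notin> set (take g p)" "Suc n \<notin> set (drop g p)"
    using assms(2) by (auto dest: in_set_takeD in_set_dropD)
  {
    assume "jump Leftward (Suc n) d (ins g p) q"
    then obtain xs ys zs where *: "ins g p = (xs @ ys) @ Suc n # zs"
      "q = xs @ Suc n # ys @ zs" "length ys = d" "d > 0" by auto
    have "take g p @ Suc n # drop g p = (xs @ ys) @ Suc n # zs"
      using *(1) unfolding ins_eq assms(1) .
    then have eq: "xs @ ys = take g p" "zs = drop g p"
      unfolding append_Cons_eq_iff[OF notin] by simp_all
    have len: "length xs + d = g" using arg_cong[OF eq(1), of length] *(3) assms(1,3) by simp
    have p: "p = xs @ ys @ zs"
      using append_take_drop_id[of g p] unfolding eq(1)[symmetric] eq(2)[symmetric] by simp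
    have "q = ins (length xs) p" using *(2) assms(1) by (subst p, simp add: ins_eq p)
    moreover have "length xs = g - d" "d \<le> g" using len by auto
    ultimately show "0 < d \<and> d \<le> g \<and> q = ins (g - d) p" using *(4) by simp
  }
  assume *: "0 < d \<and> d \<le> g \<and> q = ins (g - d) p"
  define xs ys where "xs = take (g - d) p" and "ys = take d (drop (g - d) p)"
  have 1: "take g p = xs @ ys"
    using * take_add[of "g - d" d p] unfolding xs_def ys_def by simp
  have 2: "drop (g - d) p = ys @ drop g p"
    using * append_take_drop_id[of d "drop (g - d) p"] unfolding ys_def by simp
  have "length ys = d" using * assms unfolding ys_def by simp
  moreover have "\<forall>y\<in>set ys. y < Suc n"
    using assms(2) unfolding ys_def by (auto dest!: in_set_takeD in_set_dropD)
  moreover have "ins g p = xs @ ys @ [Suc n] @ drop g p"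
    using assms(1) 1 by (simp add: ins_eq)
  moreover have "q = xs @ [Suc n] @ ys @ drop g p"
    using assms(1) * 2 by (simp add: ins_eq xs_def)
  ultimately show "jump Leftward (Suc n) d (ins g p) q"
    using * unfolding jump.simps by blast
qed

text \<open>The largest letter may jump over any block and leaves the rest of the word unchanged, so
  its jumps amount to changing the gap. Minimality then says that no gap strictly in between yields
  a word of \<open>L\<close>.\<close>

lemma minimal_jump_max:
  assumes p: "length p = n" "set p \<subseteq> {1..n}" and g: "g \<le> n"
  shows "minimal_jump L dir (Suc n) (ins g p) q \<longleftrightarrow>
    (\<exists>k\<le>n. q = ins k p \<and>
       (case dir of Rightward \<Rightarrow> g < k \<and> (\<forall>l. g < l \<and> l < k \<longrightarrow> ins l p \<notin> L)
        | Leftward \<Rightarrow> k < g \<and> (\<forall>l. k < l \<and> l < g \<longrightarrow> ins l p \<notin> L)))" (is "?l \<longleftrightarrow> ?r")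
proof (cases dir)
  case Rightward
  show ?thesis
  proof
    assume ?l
    then obtain d where d: "0 < d" "g + d \<le> n" "q = ins (g + d) p"
      and min: "\<And>d' q'. d' < d \<Longrightarrow> 0 < d' \<Longrightarrow> g + d' \<le> n \<Longrightarrow> ins (g + d') p \<notin> L"
      unfolding minimal_jump_def Rightward jump_max_Rightward[OF p g] by blast
    have "ins l p \<notin> L" if "g < l" "l < g + d" for l
      using min[of "l - g"] d that by simp
    with d Rightward show ?r by auto
  next
    assume ?r
    with Rightward obtain k where k: "k \<le> n" "q = ins k p" "g < k"
      "\<And>l. g < l \<Longrightarrow> l < k \<Longrightarrow> ins l p \<notin> L" by auto
    then show ?l
      unfolding minimal_jump_def Rightward jump_max_Rightward[OF p g]
      by (intro exI[of _ "k - g"]) auto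
  qed
next
  case Leftward
  show ?thesis
  proof
    assume ?l
    then obtain d where d: "0 < d" "d \<le> g" "q = ins (g - d) p"
      and min: "\<And>d' q'. d' < d \<Longrightarrow> 0 < d' \<Longrightarrow> d' \<le> g \<Longrightarrow> ins (g - d') p \<notin> L"
      unfolding minimal_jump_def Leftward jump_max_Leftward[OF p g] by blast
    have "ins l p \<notin> L" if "l < g" "g - d < l" for l
      using min[of "g - l"] d that by simp
    with d g Leftward show ?r by (intro exI[of _ "g - d"]) auto
  next
    assume ?r
    with Leftward obtain k where k: "k \<le> n" "q = ins k p" "k < g"
      "\<And>l. k < l \<Longrightarrow> l < g \<Longrightarrow> ins l p \<notin> L" by auto
    then show ?l
      unfolding minimal_jump_def Leftward jump_max_Leftward[OF p g]
      by (intro exI[of _ "g - k"]) auto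
  qed
qed

section \<open>Jumps of smaller letters while the largest letter stands at an end\<close>

lemma jump_mem: "jump dir v d p q \<Longrightarrow> v \<in> set p \<and> length q = length p \<and> set q = set p"
  by (cases dir) auto

text \<open>A letter can only jump over smaller ones, so \<open>v\<close> never passes
  \<open>N\<close>, and \<open>N\<close> itself is not the jumping letter; hence \<open>N\<close>
  stays in front.\<close>

lemma jump_Cons_greater:
  assumes "v < N"
  shows "jump dir v d (N # p) q \<longleftrightarrow> (\<exists>q'. q = N # q' \<and> jump dir v d p q')"
proof
  show "jump dir v d (N # p) q" if "\<exists>q'. q = N # q' \<and> jump dir v d p q'"
    using that
    by (cases dir) (simp_all, (metis Cons_eq_appendI)+)
  assume j: "jump dir v d (N # p) q"
  show "\<exists>q'. q = N # q' \<and> jump dir v d p q'"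
  proof (cases dir)
    case Rightward
    with j obtain xs ys zs where *: "N # p = xs @ [v] @ ys @ zs" "q = xs @ ys @ [v] @ zs"
      "length ys = d" "d > 0" "\<forall>y\<in>set ys. y < v" by auto
    with assms obtain xs' where "xs = N # xs'" by (cases xs) auto
    with * Rightward show ?thesis by auto
  next
    case Leftward
    with j obtain xs ys zs where *: "N # p = xs @ ys @ [v] @ zs" "q = xs @ [v] @ ys @ zs"
      "length ys = d" "d > 0" "\<forall>y\<in>set ys. y < v" by auto
    with assms obtain xs' where "xs = N # xs'" by (cases xs; cases ys) auto
    with * Leftward show ?thesis by auto
  qed
qed

lemma jump_snoc_greater:
  assumes "v < N"
  shows "jump dir v d (p @ [N]) q \<longleftrightarrow> (\<exists>q'. q = q' @ [N] \<and> jump dir v d p q')"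
proof
  show "jump dir v d (p @ [N]) q" if "\<exists>q'. q = q' @ [N] \<and> jump dir v d p q'"
    using that
    by (cases dir) (simp_all, (metis append_Cons append_assoc)+)
  assume j: "jump dir v d (p @ [N]) q"
  show "\<exists>q'. q = q' @ [N] \<and> jump dir v d p q'"
  proof (cases dir)
    case Rightward
    with j obtain xs ys zs where *: "p @ [N] = xs @ [v] @ ys @ zs" "q = xs @ ys @ [v] @ zs"
      "length ys = d" "d > 0" "\<forall>y\<in>set ys. y < v" by auto
    with assms obtain zs' where "zs = zs' @ [N]"
      by (cases zs rule: rev_cases; cases ys rule: rev_cases) auto
    with * Rightward show ?thesis by auto
  next
    case Leftward
    with j obtain xs ys zs where *: "p @ [N] = xs @ ys @ [v] @ zs" "q = xs @ [v] @ ys @ zs"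
      "length ys = d" "d > 0" "\<forall>y\<in>set ys. y < v" by auto
    with assms obtain zs' where "zs = zs' @ [N]"
      by (cases zs rule: rev_cases) auto
    with * Leftward show ?thesis by auto
  qed
qed

lemma jump_ins_boundary:
  assumes "length p = n" "e \<in> {0, n}" "v \<le> n"
  shows "jump dir v d (ins e p) q \<longleftrightarrow> (\<exists>q'. q = ins e q' \<and> jump dir v d p q')"
proof -
  have "e = 0 \<or> e = n" using assms(2) by blast
  then show ?thesis
  proof
    assume "e = 0"
    then show ?thesis
      using jump_Cons_greater[of v "Suc n" dir d p q] assms(1,3) jump_mem[of dir v d p]
      by (auto simp: ins_0)
  next
    assume e: "e = n"
    then have p: "ins e p = p @ [Suc n]" using assms(1) ins_length[of p] by simp
    have q: "ins e q' = q' @ [Suc n]" if "jump dir v d p q'" for q'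
      using jump_mem[OF that] assms(1) ins_length[of q'] e by simp
    show ?thesis
      unfolding p using jump_snoc_greater[of v "Suc n" dir d p q] assms(3) q by (metis le_imp_less_Suc)
  qed
qed

lemma sorted_wrt_direction:
  fixes gs :: "nat list"
  assumes "sorted_wrt (<) gs" "(if c then rev gs else gs) = g1 @ g2" "x \<in> set g1" "y \<in> set g2"
  shows "if c then y < x else x < y"
proof (cases c)
  case True
  then have "gs = rev g2 @ rev g1" using assms(2) by (simp add: rev_swap)
  with assms True show ?thesis by (auto simp: sorted_wrt_append)
qed (use assms in \<open>auto simp: sorted_wrt_append\<close>)

text \<open>The inductive step for Algorithm J, separated from hypergraphs: any forced run on
  shorter words lifts, provided that each sweep ends at a place that is available over the next word
  as well. For the right end this is \<open>last (gaps x) = n\<close>. In the first case of the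
  hypothesis on \<open>hd\<close> the left end is always available; in the second case
  \<open>n\<close> is the only gap, and each sweep consists of one word.\<close>

lemma J_run_zigzag:
  fixes enc :: "'a \<Rightarrow> nat list" and gaps :: "'a \<Rightarrow> nat list"
  assumes run: "J_run (enc ` set xs) (map enc xs)"
    and inj: "inj_on enc (set xs)" and dist: "distinct xs"
    and perm: "\<And>x. x \<in> set xs \<Longrightarrow> length (enc x) = n \<and> set (enc x) \<subseteq> {1..n}"
    and gaps: "\<And>x. x \<in> set xs \<Longrightarrow> gaps x \<noteq> [] \<and> sorted_wrt (<) (gaps x) \<and> last (gaps x) = n"
    and hd: "(\<forall>x\<in>set xs. hd (gaps x) = 0) \<or> (\<forall>x\<in>set xs. hd (gaps x) = n)"
  shows "J_run (\<Union>x\<in>set xs. (\<lambda>g. ins g (enc x)) ` set (gaps x))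
           (zigzag b (\<lambda>x. map (\<lambda>g. ins g (enc x)) (gaps x)) xs)"
  unfolding J_run_def
proof (intro allI impI)
  define L where "L = (\<Union>x\<in>set xs. (\<lambda>g. ins g (enc x)) ` set (gaps x))"
  define f where "f = (\<lambda>x. map (\<lambda>g. ins g (enc x)) (gaps x))"
  fix us ys q
  assume "zigzag b f xs = us @ ys" and "us \<noteq> []"
  then obtain xs1 x xs2 c f1 f2 where split: "xs = xs1 @ x # xs2" "f1 \<noteq> []"
    "(if c then rev (f x) else f x) = f1 @ f2"
    "us = zigzag b f xs1 @ f1" "ys = f2 @ zigzag (\<not> c) f xs2"
    by (rule zigzag_split)
  \<comment> \<open>\<open>G x\<close> lists the gaps of the current block in the order of
    traversal: \<open>g1\<close> is visited, \<open>g2\<close> is still to come, and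
    \<open>g\<close> below is the current gap.\<close>
  define G where "G = (\<lambda>x. if c then rev (gaps x) else gaps x)"
  have "map (\<lambda>g. ins g (enc x)) (G x) = f1 @ f2"
    using split(3) by (simp add: G_def f_def rev_map split: if_splits)
  then obtain g1 g2 where G: "G x = g1 @ g2"
    and f1: "f1 = map (\<lambda>g. ins g (enc x)) g1" and f2: "f2 = map (\<lambda>g. ins g (enc x)) g2"
    by (auto simp: map_eq_append_conv)
  define p where "p = enc x"
  define g where "g = last g1"
  have x: "x \<in> set xs" using split(1) by simp
  have p: "length p = n" "set p \<subseteq> {1..n}" using perm[OF x] by (auto simp: p_def)
  have gap_le: "g \<le> n" if "x \<in> set xs" "g \<in> set (gaps x)" for x g
  proof -
    have "g = last (gaps x) \<or> g < last (gaps x)"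
      using that gaps[of x]
      by (cases "gaps x" rule: rev_cases) (auto simp: sorted_wrt_append)
    with gaps[OF that(1)] show ?thesis by auto
  qed
  have set_G: "set (gaps x) = set g1 \<union> set g2"
    using arg_cong[OF G, of set] by (auto simp: G_def split: if_splits)
  have g1: "g1 \<noteq> []" using split(2) f1 by simp
  then have g_g1: "g \<in> set g1" by (simp add: g_def)
  then have g: "g \<in> set (gaps x)" "g \<le> n" using gap_le[OF x] set_G by auto
  have notin: "Suc n \<notin> set (enc y)" if "y \<in> set xs" for y
    using perm[OF that] by auto
  have ins_iff: "ins k p = ins l (enc y) \<longleftrightarrow> k = l \<and> x = y"
    if "y \<in> set xs" "k \<le> n" "l \<le> n" for k l y
    using ins_inject[of p n "enc y" k l] that perm[of y] notin[of y] notin[OF x] p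
      inj_onD[OF inj, of x y] x by (auto simp: p_def)
  have last_us: "last us = ins g p"
    using split(2,4) f1 g1 by (simp add: g_def p_def last_map)
  have set_us: "set us = (\<Union>y\<in>set xs1. (\<lambda>k. ins k (enc y)) ` set (gaps y)) \<union> (\<lambda>k. ins k p) ` set g1"
    using split(4) f1 by (simp add: f_def p_def)
  have in_L: "ins k p \<in> L \<longleftrightarrow> k \<in> set (gaps x)" if "k \<le> n" for k
    using ins_iff[OF _ that] gap_le x unfolding L_def by (auto simp: p_def)
  have in_us: "ins k p \<in> set us \<longleftrightarrow> k \<in> set g1" if "k \<le> n" for k
  proof
    assume "ins k p \<in> set us"
    then consider y l where "y \<in> set xs1" "l \<in> set (gaps y)" "ins k p = ins l (enc y)"
      | l where "l \<in> set g1" "ins k p = ins l p"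
      unfolding set_us by blast
    then show "k \<in> set g1"
    proof cases
      case 1
      then have "y \<in> set xs" "l \<le> n" using gap_le split(1) by auto
      with 1 ins_iff that have "x = y" by blast
      with 1(1) dist split(1) show ?thesis by auto
    next
      case 2
      then have "l \<le> n" using set_G gap_le[OF x] by blast
      with 2 ins_iff[OF x that, of l] show ?thesis by (auto simp: p_def)
    qed
  qed (simp add: set_us)
  \<comment> \<open>Among the words that arise from \<open>p\<close> exactly those with a gap in
    \<open>g2\<close> are unvisited. Minimality refers to all gaps of \<open>x\<close>, the visited
    ones included, because visited words still belong to \<open>L\<close>.\<close>
  have cand_max: "J_candidate L us dir (Suc n) q \<longleftrightarrow>
      (\<exists>k\<in>set g2. q = ins k p \<and>
       (case dir of Rightward \<Rightarrow> g < k \<and> (\<forall>l\<in>set (gaps x). \<not> (g < l \<and> l < k))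
        | Leftward \<Rightarrow> k < g \<and> (\<forall>l\<in>set (gaps x). \<not> (k < l \<and> l < g))))"
    (is "_ \<longleftrightarrow> (\<exists>k\<in>set g2. q = ins k p \<and> ?Q dir k)") for dir q
  proof
    assume cand: "J_candidate L us dir (Suc n) q"
    then have "minimal_jump L dir (Suc n) (ins g p) q" "q \<in> L" "q \<notin> set us"
      unfolding J_candidate_def last_us by auto
    then obtain k where k: "k \<le> n" "q = ins k p"
      "case dir of Rightward \<Rightarrow> g < k \<and> (\<forall>l. g < l \<and> l < k \<longrightarrow> ins l p \<notin> L)
        | Leftward \<Rightarrow> k < g \<and> (\<forall>l. k < l \<and> l < g \<longrightarrow> ins l p \<notin> L)"
      unfolding minimal_jump_max[OF p g(2)] by blast
    have "?Q dir k"
      using k(1,3) in_L gap_le[OF x] by (cases dir) auto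
    moreover have "k \<in> set g2"
      using \<open>q \<in> L\<close> \<open>q \<notin> set us\<close> k(1,2) in_L in_us set_G by auto
    ultimately show "\<exists>k\<in>set g2. q = ins k p \<and> ?Q dir k" using k(2) by blast
  next
    assume "\<exists>k\<in>set g2. q = ins k p \<and> ?Q dir k"
    then obtain k where k: "k \<in> set g2" "q = ins k p" "?Q dir k" by blast
    have kn: "k \<le> n" using k(1) set_G gap_le[OF x] by blast
    have "minimal_jump L dir (Suc n) (ins g p) q"
      unfolding minimal_jump_max[OF p g(2)]
      using k kn in_L g(2) by (intro exI[of _ k]) (cases dir; auto)
    moreover have "q \<in> L" using k kn in_L set_G by blast
    moreover have "q \<notin> set us"
    proof
      assume "q \<in> set us"
      then have "k \<in> set g1" using k(2) in_us[OF kn] by simp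
      with sorted_wrt_direction[of "gaps x" c g1 g2 k k] G k(1) gaps[OF x] show False
        by (auto simp: G_def split: if_splits)
    qed
    ultimately show "J_candidate L us dir (Suc n) q"
      unfolding J_candidate_def last_us by blast
  qed
  have cand_le: "v \<le> Suc n" if "J_candidate L us dir v q" for dir v q
  proof -
    from that obtain d where "jump dir v d (ins g p) q"
      unfolding J_candidate_def minimal_jump_def last_us by blast
    then have "v \<in> set (ins g p)" using jump_mem by blast
    then show ?thesis using p by (auto simp: set_ins)
  qed
  have "J_step L us q \<longleftrightarrow> (\<exists>zs. ys = q # zs)"
  proof (cases g2)
    case (Cons g' g2')
    \<comment> \<open>The block is traversed monotonically, so all of \<open>g2\<close> lies on one
      side of \<open>g\<close>. This makes the direction unambiguous, and minimality singles out the
      first element of \<open>g2\<close>.\<close>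
    define D where "D = (if c then Leftward else Rightward)"
    have dir: "if c then l < k else k < l" if "k \<in> set g1" "l \<in> set g2" for k l
      using sorted_wrt_direction[of "gaps x" c g1 g2 k l] G gaps[OF x] that by (simp add: G_def)
    have dir': "if c then l < g' else g' < l" if "l \<in> set g2'" for l
      using sorted_wrt_direction[of "gaps x" c "g1 @ [g']" g2' g' l] G gaps[OF x] that Cons
      by (simp add: G_def)
    have dir'': "if c then g < k else k < g" if "k \<in> set g1" "k \<noteq> g" for k
    proof -
      obtain g1' where g1': "g1 = g1' @ [g]" using g1 unfolding g_def by (metis append_butlast_last_id)
      then have "k \<in> set g1'" using that by auto
      then show ?thesis
        using sorted_wrt_direction[of "gaps x" c g1' "g # g2" k g] G gaps[OF x] g1'
        by (simp add: G_def)
    qed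
    have iff: "J_candidate L us dir (Suc n) q \<longleftrightarrow> dir = D \<and> q = ins g' p" for dir q
    proof
      assume "J_candidate L us dir (Suc n) q"
      then obtain k where k: "k \<in> set g2" "q = ins k p"
        "case dir of Rightward \<Rightarrow> g < k \<and> (\<forall>l\<in>set (gaps x). \<not> (g < l \<and> l < k))
        | Leftward \<Rightarrow> k < g \<and> (\<forall>l\<in>set (gaps x). \<not> (k < l \<and> l < g))"
        unfolding cand_max by blast
      have "dir = D" using dir[OF g_g1 k(1)] k(3) by (cases dir; cases c) (auto simp: D_def)
      have "g' \<in> set g2" using Cons by simp
      then have "g' \<in> set (gaps x)" using set_G by blast
      have "k = g'"
      proof (rule ccontr)
        assume "k \<noteq> g'"
        then have "k \<in> set g2'" using k(1) Cons by auto
        from dir'[OF this] dir[OF g_g1 \<open>g' \<in> set g2\<close>] k(3) \<open>dir = D\<close> \<open>g' \<in> set (gaps x)\<close>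
        show False by (cases c) (auto simp: D_def)
      qed
      with \<open>dir = D\<close> k(2) show "dir = D \<and> q = ins g' p" by simp
    next
      assume *: "dir = D \<and> q = ins g' p"
      have "g' \<in> set g2" using Cons by simp
      have "case D of Rightward \<Rightarrow> g < g' \<and> (\<forall>l\<in>set (gaps x). \<not> (g < l \<and> l < g'))
        | Leftward \<Rightarrow> g' < g \<and> (\<forall>l\<in>set (gaps x). \<not> (g' < l \<and> l < g))"
      proof -
        have "\<not> (if c then g' < l \<and> l < g else g < l \<and> l < g')" if "l \<in> set (gaps x)" for l
        proof -
          from that consider "l \<in> set g1" "l \<noteq> g" | "l = g" | "l = g'" | "l \<in> set g2'"
            using set_G Cons by auto
          then show ?thesis
            by cases (use dir''[of l] dir'[of l] in \<open>auto split: if_splits\<close>)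
        qed
        then show ?thesis using dir[OF g_g1 \<open>g' \<in> set g2\<close>] by (auto simp: D_def)
      qed
      with * \<open>g' \<in> set g2\<close> show "J_candidate L us dir (Suc n) q" unfolding cand_max by blast
    qed
    have "J_step L us q \<longleftrightarrow> q = ins g' p"
    proof
      assume "J_step L us q"
      then obtain dir v where v: "J_candidate L us dir v q"
        "\<And>dir' v' q'. J_candidate L us dir' v' q' \<Longrightarrow> v' \<le> v"
        unfolding J_step_def by blast
      have "v = Suc n" using cand_le[OF v(1)] v(2)[of D "Suc n" "ins g' p"] iff by simp
      with v(1) iff show "q = ins g' p" by simp
    next
      assume "q = ins g' p"
      then show "J_step L us q"
        unfolding J_step_def using iff cand_le by (intro exI[of _ D] exI[of _ "Suc n"]) auto
    qed
    then show ?thesis using split(5) f2 Cons by (auto simp: p_def)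
  next
    case Nil
    \<comment> \<open>The sweep over \<open>p\<close> is complete. By the uniform hypothesis on the
      first gaps, \<open>g\<close> is an end of the word at which the blocks of all other words can
      be entered too.\<close>
    have g1_G: "g1 = G x" using G Nil by simp
    have last_G: "last (G y) = (if c then hd (gaps y) else n)" if "y \<in> set xs" for y
      using gaps[OF that] by (simp add: G_def last_rev)
    have g_G: "last (G y) = g" if "y \<in> set xs" for y
      using hd last_G[OF that] last_G[OF x] that x g1_G unfolding g_def by auto
    have g_end: "g \<in> {0, n}"
      using last_G[OF x] g_G[OF x] hd x by (auto split: if_splits)
    have g_gaps: "g \<in> set (gaps y)" if "y \<in> set xs" for y
    proof -
      have "G y \<noteq> []" using gaps[OF that] by (simp add: G_def)
      then have "last (G y) \<in> set (G y)" by simp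
      then show ?thesis using g_G[OF that] by (simp add: G_def split: if_splits)
    qed
    \<comment> \<open>The shorter run at this moment. On words with the largest letter at gap
      \<open>g\<close>, membership in \<open>L\<close> and having been visited correspond to
      membership in \<open>L'\<close> and in \<open>us'\<close>; for the latter it matters that the
      block of \<open>x\<close> has been visited completely.\<close>
    define L' us' where "L' = enc ` set xs" and "us' = map enc (xs1 @ [x])"
    have last_us': "last us' = p" by (simp add: us'_def p_def)
    have no_max: "\<not> J_candidate L us dir (Suc n) q" for dir q
      unfolding cand_max using Nil by simp
    have in_L': "ins g q' \<in> L \<longleftrightarrow> q' \<in> L'" "ins g q' \<in> set us \<longleftrightarrow> q' \<in> set us'"
      if "length q' = n" "set q' \<subseteq> {1..n}" for q'
    proof -
      have q': "Suc n \<notin> set q'" using that by auto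
      have eq: "ins g q' = ins l (enc y) \<longleftrightarrow> g = l \<and> q' = enc y"
        if "y \<in> set xs" "l \<in> set (gaps y)" for y l
        using ins_inject[of q' n "enc y" g l] perm[OF that(1)] notin[OF that(1)] q'
          \<open>length q' = n\<close> g(2) gap_le[OF that] by simp
      show "ins g q' \<in> L \<longleftrightarrow> q' \<in> L'"
        unfolding L_def L'_def using eq g_gaps by blast
      have "set us = (\<Union>y\<in>set (xs1 @ [x]). (\<lambda>k. ins k (enc y)) ` set (gaps y))"
        unfolding set_us using g1_G by (auto simp: p_def G_def split: if_splits)
      moreover have "set (xs1 @ [x]) \<subseteq> set xs" using split(1) by auto
      ultimately have "ins g q' \<in> set us \<longleftrightarrow> (\<exists>y\<in>set (xs1 @ [x]). q' = enc y)"
        using eq g_gaps by blast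
      then show "ins g q' \<in> set us \<longleftrightarrow> q' \<in> set us'"
        unfolding us'_def by auto
    qed
    have min: "minimal_jump L dir v (ins g p) q \<longleftrightarrow>
        (\<exists>q'. q = ins g q' \<and> minimal_jump L' dir v p q')" if "v \<le> n" for dir v q
    proof -
      have "ins g q' \<in> L \<longleftrightarrow> q' \<in> L'" if "jump dir v d p q'" for d q'
        using in_L'(1)[of q'] jump_mem[OF that] p by simp
      then have "(\<forall>d' q''. d' < d \<longrightarrow> (\<exists>q'. q'' = ins g q' \<and> jump dir v d' p q') \<longrightarrow> q'' \<notin> L) \<longleftrightarrow>
          (\<forall>d' q'. d' < d \<longrightarrow> jump dir v d' p q' \<longrightarrow> q' \<notin> L')" for d
        by blast
      then show ?thesis
        unfolding minimal_jump_def jump_ins_boundary[OF p(1) g_end that] by blast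
    qed
    have cand: "J_candidate L us dir v q \<longleftrightarrow> v \<le> n \<and> (\<exists>q'. q = ins g q' \<and> J_candidate L' us' dir v q')"
      for dir v q
    proof
      assume *: "J_candidate L us dir v q"
      with cand_le[OF *] no_max have v: "v \<le> n" by (metis le_Suc_eq)
      with * min obtain q' where q': "q = ins g q'" "minimal_jump L' dir v p q'"
        unfolding J_candidate_def last_us by blast
      then obtain d where "jump dir v d p q'" unfolding minimal_jump_def by blast
      with jump_mem p have "length q' = n" "set q' \<subseteq> {1..n}" by auto
      with in_L' * q' v show "v \<le> n \<and> (\<exists>q'. q = ins g q' \<and> J_candidate L' us' dir v q')"
        unfolding J_candidate_def last_us' by blast
    next
      assume "v \<le> n \<and> (\<exists>q'. q = ins g q' \<and> J_candidate L' us' dir v q')"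
      then obtain q' where v: "v \<le> n" and q': "q = ins g q'" "J_candidate L' us' dir v q'" by blast
      then have m: "minimal_jump L' dir v p q'" unfolding J_candidate_def last_us' by blast
      then obtain d where "jump dir v d p q'" unfolding minimal_jump_def by blast
      with jump_mem p have "length q' = n" "set q' \<subseteq> {1..n}" by auto
      with in_L' q' v m min show "J_candidate L us dir v q"
        unfolding J_candidate_def last_us by blast
    qed
    have le': "v \<le> n \<and> length q' = n \<and> Suc n \<notin> set q'" if "J_candidate L' us' dir v q'" for dir v q'
    proof -
      from that obtain d where "jump dir v d p q'"
        unfolding J_candidate_def minimal_jump_def last_us' by blast
      with jump_mem[OF this] p show ?thesis by auto
    qed
    have step: "J_step L us q \<longleftrightarrow> (\<exists>q'. q = ins g q' \<and> J_step L' us' q')"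
    proof
      assume "J_step L us q"
      then obtain dir v where v: "J_candidate L us dir v q"
        "\<And>dir' v' q'. J_candidate L us dir' v' q' \<Longrightarrow> v' \<le> v"
        "\<And>dir' q'. J_candidate L us dir' v q' \<Longrightarrow> dir' = dir"
        unfolding J_step_def by blast
      from v(1) obtain q' where "q = ins g q'" "J_candidate L' us' dir v q'" unfolding cand by blast
      moreover have "v' \<le> v" if "J_candidate L' us' dir' v' q''" for dir' v' q''
        using v(2)[of dir' v' "ins g q''"] that le'[OF that] unfolding cand by blast
      moreover have "dir' = dir" if "J_candidate L' us' dir' v q''" for dir' q''
        using v(3)[of dir' "ins g q''"] that le'[OF that] unfolding cand by blast
      ultimately show "\<exists>q'. q = ins g q' \<and> J_step L' us' q'" unfolding J_step_def by blast
    next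
      assume "\<exists>q'. q = ins g q' \<and> J_step L' us' q'"
      then obtain q' dir v where v: "q = ins g q'" "J_candidate L' us' dir v q'"
        "\<And>dir' v' q'. J_candidate L' us' dir' v' q' \<Longrightarrow> v' \<le> v"
        "\<And>dir' q'. J_candidate L' us' dir' v q' \<Longrightarrow> dir' = dir"
        unfolding J_step_def by blast
      have "J_candidate L us dir v q" unfolding cand using v(1,2) le'[OF v(2)] by blast
      moreover have "v' \<le> v" if "J_candidate L us dir' v' q''" for dir' v' q''
        using that v(3) unfolding cand by blast
      moreover have "dir' = dir" if "J_candidate L us dir' v q''" for dir' q''
        using that v(4) unfolding cand by blast
      ultimately show "J_step L us q" unfolding J_step_def by blast
    qed
    have "J_step L' us' q' \<longleftrightarrow> (\<exists>zs. map enc xs2 = q' # zs)" for q'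
      using J_runD[of L' us' "map enc xs2" q'] run split(1) by (simp add: L'_def us'_def)
    moreover have "(\<exists>zs. ys = q # zs) \<longleftrightarrow> (\<exists>q' zs. map enc xs2 = q' # zs \<and> q = ins g q')"
    proof (cases xs2)
      case Nil
      with f2 \<open>g2 = []\<close> split(5) show ?thesis by simp
    next
      case (Cons y xs3)
      have y: "y \<in> set xs" using Cons split(1) by simp
      have ne: "gaps y \<noteq> []" using gaps[OF y] by simp
      \<comment> \<open>The next block is traversed in the opposite direction, so it begins at the
        very gap \<open>g\<close> at which the current one ended.\<close>
      have "hd (if \<not> c then rev (f y) else f y) = ins g (enc y)"
        using g_G[OF y] ne by (auto simp: G_def f_def hd_rev last_map hd_map last_rev)
      moreover have "(if \<not> c then rev (f y) else f y) \<noteq> []" using ne by (simp add: f_def)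
      ultimately obtain zs where "(if \<not> c then rev (f y) else f y) = ins g (enc y) # zs"
        by (cases "if \<not> c then rev (f y) else f y") auto
      with Cons f2 \<open>g2 = []\<close> split(5) show ?thesis by auto
    qed
    ultimately show ?thesis unfolding step by auto
  qed
  then show "J_step (\<Union>x\<in>set xs. (\<lambda>g. ins g (enc x)) ` set (gaps x)) us q \<longleftrightarrow> (\<exists>zs. ys = q # zs)"
    by (simp add: L_def)
qed


section \<open>The skeleton of the hypergraphic polytope\<close>

lemma lookup_scaleR: "Poly_Mapping.lookup (r *\<^sub>R x) i = r *\<^sub>R Poly_Mapping.lookup x i"
proof -
  have "finite {i. r *\<^sub>R Poly_Mapping.lookup x i \<noteq> 0}"
    by (rule finite_subset[OF _ finite_keys[of x]]) (auto simp: in_keys_iff)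
  then show ?thesis
    unfolding scaleR_poly_mapping_def by (subst lookup_Abs_poly_mapping) auto
qed

text \<open>The library's supporting hyperplanes are given by an inner product, which the ambient space
  of the polytope lacks.\<close>

lemma convex_hull_maximizers_face_of:
  fixes F :: "'a::real_vector \<Rightarrow> real"
  assumes F: "linear F" and V: "finite V" and le: "\<And>v. v \<in> V \<Longrightarrow> F v \<le> M"
  shows "convex hull {v \<in> V. F v = M} face_of convex hull V"
proof -
  define T where "T = {x \<in> convex hull V. F x = M}"
  have le': "F x \<le> M" if "x \<in> convex hull V" for x
  proof -
    have "convex {x. F x \<le> M}"
      using convex_linear_vimage[OF F, of "{..M}"] by (simp add: vimage_def)
    then have "convex hull V \<subseteq> {x. F x \<le> M}" using le by (intro hull_minimal) auto
    with that show ?thesis by blast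
  qed
  have "convex {x. F x = M}"
    using convex_linear_vimage[OF F, of "{M}"] by (simp add: vimage_def)
  then have conv: "convex T"
    unfolding T_def Collect_conj_eq by (simp add: convex_Int)
  have "T face_of convex hull V"
    unfolding face_of_def
  proof (intro conjI ballI impI)
    fix a b x
    assume a: "a \<in> convex hull V" and b: "b \<in> convex hull V" and x: "x \<in> T" "x \<in> open_segment a b"
    then obtain u where u: "x = (1 - u) *\<^sub>R a + u *\<^sub>R b" "0 < u" "u < 1"
      by (auto simp: in_segment)
    have "F x = (1 - u) * F a + u * F b"
      by (simp add: u(1) linear_add[OF F] linear_scale[OF F])
    then have "(1 - u) * (M - F a) + u * (M - F b) = 0"
      using x(1) by (simp add: T_def algebra_simps)
    moreover have "0 \<le> (1 - u) * (M - F a)" "0 \<le> u * (M - F b)"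
      using le'[OF a] le'[OF b] u by simp_all
    ultimately have "(1 - u) * (M - F a) = 0" "u * (M - F b) = 0" by linarith+
    then have "F a = M" "F b = M" using u by simp_all
    with a b show "a \<in> T" "b \<in> T" by (simp_all add: T_def)
  qed (use conv in \<open>auto simp: T_def\<close>)
  moreover have "T = convex hull {v \<in> V. F v = M}"
  proof
    show "convex hull {v \<in> V. F v = M} \<subseteq> T"
      using conv by (intro hull_minimal) (auto simp: T_def hull_inc)
    show "T \<subseteq> convex hull {v \<in> V. F v = M}"
    proof
      fix x assume x: "x \<in> T"
      then obtain u where u: "\<And>v. v \<in> V \<Longrightarrow> 0 \<le> u v" "sum u V = 1" "(\<Sum>v\<in>V. u v *\<^sub>R v) = x"
        unfolding T_def convex_hull_finite[OF V] by auto
      have "(\<Sum>v\<in>V. u v * F v) = F x"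
        by (simp add: u(3)[symmetric] linear_sum[OF F] linear_scale[OF F])
      then have "(\<Sum>v\<in>V. u v * (M - F v)) = 0"
        using x u(2) by (simp add: T_def right_diff_distrib sum_subtractf flip: sum_distrib_right)
      then have "\<forall>v\<in>V. u v * (M - F v) = 0"
        using V u(1) le by (subst (asm) sum_nonneg_eq_0_iff) auto
      then have zero: "\<forall>v \<in> V - {v \<in> V. F v = M}. u v = 0" by auto
      then have "sum u {v \<in> V. F v = M} = sum u V"
        "(\<Sum>v\<in>{v \<in> V. F v = M}. u v *\<^sub>R v) = (\<Sum>v\<in>V. u v *\<^sub>R v)"
        using V by (intro sum.mono_neutral_left; simp)+
      then show "x \<in> convex hull {v \<in> V. F v = M}"
        using V u by (subst convex_hull_finite) auto
    qed
  qed
  ultimately show ?thesis by simp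
qed

text \<open>The in-degree vector, summed over hyperedges instead of vertices. In this form it is
  visibly a sum of one vertex from each simplex.\<close>

definition orientation_vec :: "nat set set \<Rightarrow> (nat set \<Rightarrow> nat) \<Rightarrow> nat \<Rightarrow>\<^sub>0 real" where
  "orientation_vec E h = (\<Sum>A\<in>E. unit_vec (h A))"

definition weight_functional :: "nat \<Rightarrow> (nat \<Rightarrow> real) \<Rightarrow> (nat \<Rightarrow>\<^sub>0 real) \<Rightarrow> real" where
  "weight_functional n w x = (\<Sum>v\<in>{1..n}. w v * Poly_Mapping.lookup x v)"

lemma linear_weight_functional: "linear (weight_functional n w)"
  by (rule linearI)
    (simp_all add: weight_functional_def lookup_add lookup_scaleR distrib_left sum.distrib
      sum_distrib_left mult_ac)

lemma weight_functional_unit_vec: "v \<in> {1..n} \<Longrightarrow> weight_functional n w (unit_vec v) = w v"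
  by (simp add: weight_functional_def unit_vec_def lookup_single when_def if_distrib cong: if_cong)

text \<open>The size of the principal down-set in the preorder generated by \<open>S\<close>. It is
  monotone, and comparable elements get the same value only if they are equivalent, so as a weight
  it separates exactly the strict relations. It is used with \<open>S\<close> the arcs of
  \<open>h\<close> for vertices of the polytope, and with one reversed arc added for edges.\<close>

definition down_card :: "nat \<Rightarrow> (nat \<times> nat) set \<Rightarrow> nat \<Rightarrow> real" where
  "down_card n S v = real (card {u \<in> {1..n}. (u, v) \<in> S\<^sup>*})"

lemma down_card_mono: "(u, v) \<in> S\<^sup>* \<Longrightarrow> down_card n S u \<le> down_card n S v"
  unfolding down_card_def by (auto intro!: card_mono)

lemma down_card_eqD:
  assumes "(u, v) \<in> S\<^sup>*" "v \<in> {1..n}" "down_card n S u = down_card n S v"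
  shows "(v, u) \<in> S\<^sup>*"
proof -
  have "{x \<in> {1..n}. (x, u) \<in> S\<^sup>*} = {x \<in> {1..n}. (x, v) \<in> S\<^sup>*}"
    using assms(1,3) unfolding down_card_def by (intro card_subset_eq) auto
  with assms(2) show ?thesis by blast
qed

section \<open>Vertices and edges of the hypergraphic polytope\<close>

context
  fixes n :: nat and E :: "nat set set"
  assumes E: "hypergraph n E"
begin

lemma hyperedge: "A \<in> E \<Longrightarrow> A \<subseteq> {1..n} \<and> A \<noteq> {}"
  using E by (auto simp: hypergraph_def)

lemma finite_hyperedges: "finite E"
  using E unfolding hypergraph_def by (meson finite_Pow_iff finite_atLeastAtMost finite_subset)

lemma orientation_range: "h \<in> orientations E \<Longrightarrow> A \<in> E \<Longrightarrow> h A \<in> A \<and> h A \<in> {1..n}"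
  using hyperedge unfolding orientations_def by (meson PiE_mem subsetD)

lemma arcs_head: "h \<in> orientations E \<Longrightarrow> A \<in> E \<Longrightarrow> b \<in> A \<Longrightarrow> b \<noteq> h A \<Longrightarrow> (b, h A) \<in> arcs E h"
  using orientation_range unfolding arcs_def by blast

lemma finite_orientations: "finite (orientations E)"
  unfolding orientations_def
  using finite_hyperedges hyperedge by (intro finite_PiE) (auto intro: finite_subset)

lemma indegree_vec_eq:
  assumes "h \<in> orientations E"
  shows "indegree_vec n E h = orientation_vec E h"
proof -
  have "orientation_vec E h = (\<Sum>i\<in>{1..n}. \<Sum>A\<in>{A \<in> E. h A = i}. unit_vec (h A))"
    unfolding orientation_vec_def
    by (rule sum.group[symmetric]) (use finite_hyperedges orientation_range[OF assms] in auto)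
  also have "\<dots> = (\<Sum>i\<in>{1..n}. \<Sum>A\<in>{A \<in> E. h A = i}. unit_vec i)"
    by (intro sum.cong) auto
  finally show ?thesis
    by (simp add: indegree_vec_def indegree_def sum_constant_scaleR del: sum_constant)
qed

text \<open>Convex hulls commute with Minkowski sums, and choosing one vertex of each simplex
  amounts to choosing an orientation, acyclic or not.\<close>

lemma hypergraphic_polytope_eq:
  "hypergraphic_polytope E = convex hull (orientation_vec E ` orientations E)"
proof -
  have "(\<Sum>A\<in>E. unit_vec ` A) = orientation_vec E ` orientations E"
  proof
    show "orientation_vec E ` orientations E \<subseteq> (\<Sum>A\<in>E. unit_vec ` A)"
      unfolding set_sum_alt[OF finite_hyperedges] orientation_vec_def
      using orientation_range by blast
    show "(\<Sum>A\<in>E. unit_vec ` A) \<subseteq> orientation_vec E ` orientations E"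
    proof
      fix x assume "x \<in> (\<Sum>A\<in>E. unit_vec ` A)"
      then obtain s where s: "x = sum s E" "\<forall>A\<in>E. s A \<in> unit_vec ` A"
        unfolding set_sum_alt[OF finite_hyperedges] by blast
      then have "\<forall>A\<in>E. \<exists>a. a \<in> A \<and> s A = unit_vec a" by blast
      then obtain h where h: "\<forall>A\<in>E. h A \<in> A \<and> s A = unit_vec (h A)"
        using bchoice[of E "\<lambda>A a. a \<in> A \<and> s A = unit_vec a"] by blast
      then have "restrict h E \<in> orientations E" "x = orientation_vec E (restrict h E)"
        using s(1) by (auto simp: orientations_def orientation_vec_def)
      then show "x \<in> orientation_vec E ` orientations E" by blast
    qed
  qed
  then show ?thesis
    unfolding hypergraphic_polytope_def by (simp flip: convex_hull_set_sum)
qed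

lemma weight_functional_orientation_vec:
  assumes "h \<in> orientations E"
  shows "weight_functional n w (orientation_vec E h) = (\<Sum>A\<in>E. w (h A))"
  unfolding orientation_vec_def linear_sum[OF linear_weight_functional]
  using orientation_range[OF assms] weight_functional_unit_vec by (intro sum.cong) auto

text \<open>Each hyperedge contributes at most the weight of its head under \<open>h\<close>, so
  equal totals force equality hyperedge by hyperedge.\<close>

lemma maximal_weight_eqD:
  fixes w :: "nat \<Rightarrow> real"
  assumes "h \<in> orientations E" "k \<in> orientations E"
    and "\<And>A b. A \<in> E \<Longrightarrow> b \<in> A \<Longrightarrow> w b \<le> w (h A)"
    and "weight_functional n w (orientation_vec E k) = weight_functional n w (orientation_vec E h)"
    and "A \<in> E"
  shows "w (k A) = w (h A)"
  using assms finite_hyperedges orientation_range[OF assms(2)]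
  by (intro sum_mono_inv[of "\<lambda>A. w (k A)" E "\<lambda>A. w (h A)" A])
    (simp_all add: weight_functional_orientation_vec)

lemma maximal_weight_face:
  fixes w :: "nat \<Rightarrow> real"
  assumes "h \<in> orientations E"
    and "\<And>A b. A \<in> E \<Longrightarrow> b \<in> A \<Longrightarrow> w b \<le> w (h A)"
  shows "convex hull {orientation_vec E k | k. k \<in> orientations E \<and> (\<forall>A\<in>E. w (k A) = w (h A))}
           face_of hypergraphic_polytope E"
proof -
  let ?F = "weight_functional n w"
  have "convex hull {v \<in> orientation_vec E ` orientations E. ?F v = ?F (orientation_vec E h)}
      face_of hypergraphic_polytope E"
    unfolding hypergraphic_polytope_eq
  proof (rule convex_hull_maximizers_face_of[OF linear_weight_functional])
    fix v assume "v \<in> orientation_vec E ` orientations E"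
    then show "?F v \<le> ?F (orientation_vec E h)"
      using assms orientation_range by (auto simp: weight_functional_orientation_vec intro!: sum_mono)
  qed (simp add: finite_orientations)
  also have "{v \<in> orientation_vec E ` orientations E. ?F v = ?F (orientation_vec E h)} =
      {orientation_vec E k | k. k \<in> orientations E \<and> ?F (orientation_vec E k) = ?F (orientation_vec E h)}"
    by blast
  also have "\<dots> = {orientation_vec E k | k. k \<in> orientations E \<and> (\<forall>A\<in>E. w (k A) = w (h A))}"
  proof -
    have "?F (orientation_vec E k) = ?F (orientation_vec E h) \<longleftrightarrow> (\<forall>A\<in>E. w (k A) = w (h A))"
      if k: "k \<in> orientations E" for k
      using maximal_weight_eqD[of h k w, OF assms(1) k assms(2)]
        weight_functional_orientation_vec[OF k, of w] weight_functional_orientation_vec[OF assms(1), of w]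
        sum.cong[of E E "\<lambda>A. w (k A)" "\<lambda>A. w (h A)"]
      by metis
    then show ?thesis by blast
  qed
  finally show ?thesis .
qed

text \<open>Where \<open>k\<close> and \<open>h\<close> differ there is an arc from the head under
  \<open>k\<close> to the head under \<open>h\<close>; equal down-set sizes would give a path back,
  hence a cycle.\<close>

lemma acyclic_orientation_unique_maximizer:
  assumes h: "h \<in> acyclic_orientations E" and k: "k \<in> orientations E"
    and eq: "\<forall>A\<in>E. down_card n (arcs E h) (k A) = down_card n (arcs E h) (h A)"
  shows "k = h"
proof
  fix A
  have h': "h \<in> orientations E" "acyclic (arcs E h)"
    using h by (auto simp: acyclic_orientations_def)
  show "k A = h A"
  proof (cases "A \<in> E")
    case True
    show ?thesis
    proof (rule ccontr)
      assume ne: "k A \<noteq> h A"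
      then have arc: "(k A, h A) \<in> arcs E h"
        using arcs_head[OF h'(1) True] orientation_range[OF k True] by blast
      then have "(h A, k A) \<in> (arcs E h)\<^sup>*"
        using down_card_eqD[of "k A" "h A" "arcs E h" n] eq True orientation_range[OF h'(1) True] by blast
      with arc h'(2) show False
        unfolding acyclic_def by (meson rtrancl_into_trancl2)
    qed
  qed (use h' k in \<open>auto simp: orientations_def PiE_def extensional_def\<close>)
qed

lemma down_card_le_head:
  assumes "h \<in> orientations E" "arcs E h \<subseteq> S" "A \<in> E" "b \<in> A"
  shows "down_card n S b \<le> down_card n S (h A)"
  using arcs_head[OF assms(1,3,4)] assms(2) by (cases "b = h A") (auto intro: down_card_mono)

lemma inj_on_orientation_vec: "inj_on (orientation_vec E) (acyclic_orientations E)"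
proof (rule inj_onI)
  fix h k assume hk: "h \<in> acyclic_orientations E" "k \<in> acyclic_orientations E"
    and eq: "orientation_vec E h = orientation_vec E k"
  have o: "h \<in> orientations E" "k \<in> orientations E" using hk by (auto simp: acyclic_orientations_def)
  have "\<forall>A\<in>E. down_card n (arcs E h) (k A) = down_card n (arcs E h) (h A)"
    using maximal_weight_eqD[OF o, of "down_card n (arcs E h)"] down_card_le_head[OF o(1) order_refl] eq
    by simp
  then show "h = k"
    using acyclic_orientation_unique_maximizer[OF hk(1) o(2)] by simp
qed

lemma extreme_point_orientation_vec:
  assumes h: "h \<in> acyclic_orientations E"
  shows "orientation_vec E h extreme_point_of hypergraphic_polytope E"
proof -
  have o: "h \<in> orientations E" using h by (auto simp: acyclic_orientations_def)
  let ?w = "down_card n (arcs E h)"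
  have "{orientation_vec E k | k. k \<in> orientations E \<and> (\<forall>A\<in>E. ?w (k A) = ?w (h A))} =
      {orientation_vec E h}"
    using acyclic_orientation_unique_maximizer[OF h] o by blast
  then show ?thesis
    using maximal_weight_face[OF o, of ?w] down_card_le_head[OF o order_refl]
    by (simp add: face_of_singleton)
qed

text \<open>The directions \<open>d\<close> that point from \<open>x\<close> into the polytope are closed under addition and contain
  \<open>e\<^sub>i - e\<^sub>j\<close> for every arc \<open>i \<rightarrow> j\<close>. On a cycle of arcs this yields both \<open>d\<close> and \<open>- d\<close>.\<close>

lemma extreme_point_acyclic:
  assumes h: "h \<in> orientations E" and ext: "orientation_vec E h extreme_point_of hypergraphic_polytope E"
  shows "h \<in> acyclic_orientations E"
proof -
  define Z where "Z = hypergraphic_polytope E"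
  define x where "x = orientation_vec E h"
  define T where "T = {d. \<exists>\<epsilon>>0. x + \<epsilon> *\<^sub>R d \<in> Z}"
  have conv: "convex Z" by (simp add: Z_def hypergraphic_polytope_eq)
  have xZ: "x \<in> Z" using ext by (simp add: extreme_point_of_def x_def Z_def)
  \<comment> \<open>Convexity allows shorter steps, so two directions can be given a common step
    length.\<close>
  have shrink: "x + \<delta> *\<^sub>R d \<in> Z" if "x + \<epsilon> *\<^sub>R d \<in> Z" "0 < \<delta>" "\<delta> \<le> \<epsilon>" for \<delta> \<epsilon> d
  proof -
    have "(1 - \<delta> / \<epsilon>) *\<^sub>R x + (\<delta> / \<epsilon>) *\<^sub>R (x + \<epsilon> *\<^sub>R d) \<in> Z"
      using convexD_alt[OF conv xZ that(1), of "\<delta> / \<epsilon>"] that by simp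
    moreover have "(1 - \<delta> / \<epsilon>) *\<^sub>R x + (\<delta> / \<epsilon>) *\<^sub>R (x + \<epsilon> *\<^sub>R d) = x + \<delta> *\<^sub>R d"
      using that by (simp add: algebra_simps)
    ultimately show ?thesis by simp
  qed
  have add: "d + d' \<in> T" if "d \<in> T" "d' \<in> T" for d d'
  proof -
    from that obtain \<epsilon> \<epsilon>' where e: "\<epsilon> > 0" "\<epsilon>' > 0" "x + \<epsilon> *\<^sub>R d \<in> Z" "x + \<epsilon>' *\<^sub>R d' \<in> Z"
      unfolding T_def by blast
    define \<delta> where "\<delta> = min \<epsilon> \<epsilon>'"
    have d: "\<delta> > 0" "x + \<delta> *\<^sub>R d \<in> Z" "x + \<delta> *\<^sub>R d' \<in> Z"
      using e shrink unfolding \<delta>_def by auto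
    have "(1 - 1/2) *\<^sub>R (x + \<delta> *\<^sub>R d) + (1/2) *\<^sub>R (x + \<delta> *\<^sub>R d') \<in> Z"
      using convexD_alt[OF conv d(2,3), of "1/2"] by simp
    also have "(1 - 1/2) *\<^sub>R (x + \<delta> *\<^sub>R d) + (1/2) *\<^sub>R (x + \<delta> *\<^sub>R d') =
        (1/2 + 1/2) *\<^sub>R x + (\<delta> / 2) *\<^sub>R (d + d')"
      unfolding scaleR_add_left by (simp add: scaleR_add_right)
    finally show ?thesis
      unfolding T_def using d(1) by (intro CollectI exI[of _ "\<delta> / 2"]) simp
  qed
  have arc: "unit_vec i - unit_vec j \<in> T" if "(i, j) \<in> arcs E h" for i j
  proof -
    from that obtain A where A: "A \<in> E" "i \<in> A" "h A = j" unfolding arcs_def by blast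
    \<comment> \<open>Redirecting the single hyperedge \<open>A\<close> from \<open>j\<close> to
      \<open>i\<close> gives another orientation, whose vector lies in the polytope; the step length
      is 1.\<close>
    have "h(A := i) \<in> orientations E" using h A unfolding orientations_def by (auto simp: PiE_iff extensional_def)
    moreover have "orientation_vec E (h(A := i)) = x + (unit_vec i - unit_vec j)"
    proof -
      have "(\<Sum>B\<in>E - {A}. unit_vec ((h(A := i)) B)) = (\<Sum>B\<in>E - {A}. unit_vec (h B))"
        by (rule sum.cong) auto
      then show ?thesis
        unfolding x_def orientation_vec_def
        using A finite_hyperedges by (simp add: sum.remove[of E A])
    qed
    ultimately have "x + 1 *\<^sub>R (unit_vec i - unit_vec j) \<in> Z"
      unfolding Z_def hypergraphic_polytope_eq by (metis hull_inc image_eqI scaleR_one)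
    then show ?thesis unfolding T_def using zero_less_one by blast
  qed
  have path: "unit_vec i - unit_vec j \<in> T" if "(i, j) \<in> (arcs E h)\<^sup>+" for i j
    using that
  proof induction
    case (step j k)
    then show ?case using add[OF step.IH arc[OF step.hyps(2)]] by simp
  qed (rule arc)
  have "acyclic (arcs E h)"
  proof (rule ccontr)
    assume "\<not> acyclic (arcs E h)"
    then obtain a where "(a, a) \<in> (arcs E h)\<^sup>+" unfolding acyclic_def by blast
    then obtain b where b: "(a, b) \<in> arcs E h" "(b, a) \<in> (arcs E h)\<^sup>*" by (meson tranclD)
    have "a \<noteq> b" using b(1) unfolding arcs_def by blast
    then have "(b, a) \<in> (arcs E h)\<^sup>+" using rtranclD[OF b(2)] by simp
    define d where "d = unit_vec a - unit_vec b"
    have "d \<in> T" "- d \<in> T"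
      using path[OF \<open>(b, a) \<in> (arcs E h)\<^sup>+\<close>] arc[OF b(1)] unfolding d_def by simp_all
    then obtain \<epsilon> \<epsilon>' where e: "\<epsilon> > 0" "\<epsilon>' > 0" "x + \<epsilon> *\<^sub>R d \<in> Z" "x + \<epsilon>' *\<^sub>R (- d) \<in> Z"
      unfolding T_def by blast
    define \<delta> where "\<delta> = min \<epsilon> \<epsilon>'"
    have d: "\<delta> > 0" "x + \<delta> *\<^sub>R d \<in> Z" "x + \<delta> *\<^sub>R (- d) \<in> Z"
      using e(1,2) shrink[OF e(3), of \<delta>] shrink[OF e(4), of \<delta>] unfolding \<delta>_def by auto
    have "d \<noteq> 0"
    proof
      assume "d = 0"
      then have "unit_vec a = unit_vec b" unfolding d_def by simp
      then have "Poly_Mapping.lookup (unit_vec a) a = Poly_Mapping.lookup (unit_vec b) a" by simp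
      with \<open>a \<noteq> b\<close> show False by (simp add: unit_vec_def lookup_single)
    qed
    then have "(\<delta> + \<delta>) *\<^sub>R d \<noteq> 0" using d(1) by simp
    then have "(x + \<delta> *\<^sub>R d) - (x + \<delta> *\<^sub>R (- d)) \<noteq> 0"
      unfolding scaleR_add_left by simp
    then have neq: "x + \<delta> *\<^sub>R d \<noteq> x + \<delta> *\<^sub>R (- d)" by simp
    have mid: "x = (1 - 1/2) *\<^sub>R (x + \<delta> *\<^sub>R d) + (1/2) *\<^sub>R (x + \<delta> *\<^sub>R (- d))"
    proof -
      have "(1/2) *\<^sub>R (x + \<delta> *\<^sub>R d) + (1/2) *\<^sub>R (x + \<delta> *\<^sub>R (- d)) =
          (1/2) *\<^sub>R ((x + \<delta> *\<^sub>R d) + (x + \<delta> *\<^sub>R (- d)))"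
        by (rule scaleR_add_right[symmetric])
      also have "(x + \<delta> *\<^sub>R d) + (x + \<delta> *\<^sub>R (- d)) = 2 *\<^sub>R x"
        unfolding scaleR_2 by simp
      finally show ?thesis by simp
    qed
    have "x \<in> open_segment (x + \<delta> *\<^sub>R d) (x + \<delta> *\<^sub>R (- d))"
      unfolding in_segment by (intro conjI exI[of _ "1/2"] neq mid) simp_all
    with ext d(2,3) show False unfolding extreme_point_of_def x_def Z_def by blast
  qed
  with h show ?thesis by (simp add: acyclic_orientations_def)
qed

lemma extreme_points_hypergraphic_polytope:
  "{v. v extreme_point_of hypergraphic_polytope E} = orientation_vec E ` acyclic_orientations E"
proof
  show "{v. v extreme_point_of hypergraphic_polytope E} \<subseteq> orientation_vec E ` acyclic_orientations E"
  proof
    fix v assume "v \<in> {v. v extreme_point_of hypergraphic_polytope E}"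
    then have v: "v extreme_point_of hypergraphic_polytope E" by simp
    then have "v \<in> orientation_vec E ` orientations E"
      unfolding hypergraphic_polytope_eq by (rule extreme_point_of_convex_hull)
    then obtain h where "h \<in> orientations E" "v = orientation_vec E h" by blast
    with v extreme_point_acyclic[of h] show "v \<in> orientation_vec E ` acyclic_orientations E" by blast
  qed
qed (use extreme_point_orientation_vec in blast)

text \<open>If there were \<open>k\<close> strictly between \<open>i\<close> and \<open>j\<close>, then flipping \<open>j\<close> to \<open>i\<close> would close a
  cycle through \<open>k\<close>.\<close>

lemma flipped_pair_covers:
  assumes h: "acyclic (arcs E h)" and g: "acyclic (arcs E g)"
    and ij: "i \<noteq> j" "g = (\<lambda>A\<in>E. if h A = j \<and> i \<in> A then i else h A)"
    and X: "X \<in> E" "h X = j" "i \<in> X" "j \<in> X"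
    and k: "(i, k) \<in> (arcs E h)\<^sup>+" "(k, j) \<in> (arcs E h)\<^sup>+"
  shows False
proof -
  have irrefl: "(x, x) \<notin> (arcs E h)\<^sup>+" "(x, x) \<notin> (arcs E g)\<^sup>+" for x
    using h g unfolding acyclic_def by blast+
  \<comment> \<open>The flip changes only hyperedges with head \<open>j\<close>, so a path survives
    as long as it does not enter \<open>j\<close>.\<close>
  have keep: "(x, y) \<in> arcs E g" if "(x, y) \<in> arcs E h" "y \<noteq> j" for x y
    using that ij(2) unfolding arcs_def by auto
  have below: "(i, x) \<in> (arcs E g)\<^sup>+" if "(i, x) \<in> (arcs E h)\<^sup>+" "(x, j) \<in> (arcs E h)\<^sup>+" for x
    using that
  proof induction
    case (base y)
    then have "y \<noteq> j" using irrefl(1) by auto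
    then have "(i, y) \<in> arcs E g" by (rule keep[OF base(1)])
    then show ?case by blast
  next
    case (step y z)
    have "(y, j) \<in> (arcs E h)\<^sup>+"
      using step.hyps(2) step.prems by (rule trancl_into_trancl2)
    then have "(i, y) \<in> (arcs E g)\<^sup>+" by (rule step.IH)
    moreover have "z \<noteq> j" using irrefl(1) step.prems by auto
    then have "(y, z) \<in> arcs E g" by (rule keep[OF step.hyps(2)])
    ultimately show ?case by (rule trancl_into_trancl)
  qed
  from k(2) obtain x where x: "(k, x) \<in> (arcs E h)\<^sup>*" "(x, j) \<in> arcs E h"
    by (blast dest: tranclD2)
  have "(i, x) \<in> (arcs E h)\<^sup>+" using k(1) x(1) by (rule trancl_rtrancl_trancl)
  then have ix: "(i, x) \<in> (arcs E g)\<^sup>+" by (rule below) (rule r_into_trancl[OF x(2)])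
  from x(2) obtain A where A: "A \<in> E" "x \<in> A" "j \<in> A" "h A = j" "x \<noteq> j" unfolding arcs_def by blast
  \<comment> \<open>The last hyperedge \<open>A\<close> on the path into \<open>j\<close> either
    contains \<open>i\<close> and now points to \<open>i\<close>, or keeps its head
    \<open>j\<close>, from where the flipped hyperedge \<open>X\<close> leads to
    \<open>i\<close>.\<close>
  show False
  proof (cases "i \<in> A")
    case True
    moreover have "x \<noteq> i" using ix irrefl(2) by blast
    ultimately have "(x, i) \<in> arcs E g" using A ij(2) unfolding arcs_def by auto
    with ix have "(i, i) \<in> (arcs E g)\<^sup>+" by (rule trancl_into_trancl)
    with irrefl(2) show False by blast
  next
    case False
    then have "(x, j) \<in> arcs E g" using A ij(2) unfolding arcs_def by auto
    with ix have "(i, j) \<in> (arcs E g)\<^sup>+" by (rule trancl_into_trancl)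
    moreover have "(j, i) \<in> arcs E g" using X ij unfolding arcs_def by auto
    ultimately have "(i, i) \<in> (arcs E g)\<^sup>+" by (rule trancl_into_trancl)
    with irrefl(2) show False by blast
  qed
qed

text \<open>For the preorder in which \<open>i\<close> and \<open>j\<close> are identified, the only
  nontrivial class is \<open>{i, j}\<close>. An orientation of maximal weight can therefore differ
  from \<open>h\<close> only by moving some hyperedges of \<open>D\<close> from \<open>j\<close> to
  \<open>i\<close>. Each move adds the same vector \<open>d\<close>, so all maximizers lie on one
  segment, which ends at \<open>g\<close>, where all of \<open>D\<close> is moved.\<close>

lemma pair_flip_edge:
  assumes h: "h \<in> acyclic_orientations E" and g: "g \<in> acyclic_orientations E"
    and flip: "pair_flip n E h g"
  shows "closed_segment (orientation_vec E h) (orientation_vec E g) face_of hypergraphic_polytope E"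
proof -
  have o: "h \<in> orientations E" "g \<in> orientations E" "acyclic (arcs E h)" "acyclic (arcs E g)"
    using h g by (auto simp: acyclic_orientations_def)
  from flip obtain i j where ij: "i \<in> {1..n}" "j \<in> {1..n}" "i \<noteq> j"
    "g = (\<lambda>A\<in>E. if h A = j \<and> i \<in> A then i else h A)" and "g \<noteq> h"
    unfolding pair_flip_def by blast
  define D where "D = {A \<in> E. h A = j \<and> i \<in> A}"
  have "D \<noteq> {}"
  proof
    assume "D = {}"
    then have "g = restrict h E" unfolding ij(4) D_def by (intro restrict_ext) auto
    with \<open>g \<noteq> h\<close> o(1) show False by (simp add: orientations_def PiE_restrict)
  qed
  then obtain X where X: "X \<in> E" "h X = j" "i \<in> X" "j \<in> X"
    using orientation_range[OF o(1)] unfolding D_def by blast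
  \<comment> \<open>The arc \<open>(j, i)\<close> identifies \<open>i\<close> and \<open>j\<close> in the preorder of \<open>S\<close>.\<close>
  define S where "S = insert (j, i) (arcs E h)"
  define w where "w = down_card n S"
  have arc_ij: "(i, j) \<in> arcs E h" using X ij(3) unfolding arcs_def by blast
  have irrefl: "(x, x) \<notin> (arcs E h)\<^sup>+" for x
    using o(3) unfolding acyclic_def by blast
  have between: "x = i \<or> x = j" if "(i, x) \<in> (arcs E h)\<^sup>*" "(x, j) \<in> (arcs E h)\<^sup>*" for x
    using flipped_pair_covers[OF o(3,4) ij(3,4) X, of x] rtranclD[OF that(1)] rtranclD[OF that(2)]
    by blast
  have classes: "u = v \<or> u \<in> {i, j} \<and> v \<in> {i, j}" if "(u, v) \<in> S\<^sup>*" "(v, u) \<in> S\<^sup>*" for u v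
  proof -
    \<comment> \<open>A path in \<open>S\<close> either avoids the new arc or can be shortened to
      use it once, running from \<open>u\<close> to \<open>j\<close> and then from \<open>i\<close>
      to \<open>v\<close>.\<close>
    have "(u, v) \<in> (arcs E h)\<^sup>* \<or> (u, j) \<in> (arcs E h)\<^sup>* \<and> (i, v) \<in> (arcs E h)\<^sup>*"
      "(v, u) \<in> (arcs E h)\<^sup>* \<or> (v, j) \<in> (arcs E h)\<^sup>* \<and> (i, u) \<in> (arcs E h)\<^sup>*"
      using that unfolding S_def rtrancl_insert by auto
    moreover have "u = v" if uv: "(u, v) \<in> (arcs E h)\<^sup>*" "(v, u) \<in> (arcs E h)\<^sup>*"
      using rtranclD[OF uv(1)] trancl_rtrancl_trancl[OF _ uv(2)] irrefl by blast
    moreover have "u \<in> {i, j} \<and> v \<in> {i, j}"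
      if "(i, u) \<in> (arcs E h)\<^sup>*" "(u, v) \<in> (arcs E h)\<^sup>*" "(v, j) \<in> (arcs E h)\<^sup>*" for u v
      using between[of u] between[of v] that rtrancl_trans[of _ _ "arcs E h"] by blast
    moreover have "u \<in> {i, j}" if "(i, u) \<in> (arcs E h)\<^sup>*" "(u, j) \<in> (arcs E h)\<^sup>*" for u
      using between[OF that] by blast
    ultimately show ?thesis by blast
  qed
  have max: "w b \<le> w (h A)" if "A \<in> E" "b \<in> A" for A b
    using down_card_le_head[OF o(1) _ that] unfolding w_def S_def by blast
  have w_ij: "w i = w j"
    unfolding w_def using arc_ij by (intro antisym down_card_mono) (auto simp: S_def)
  have "{orientation_vec E k | k. k \<in> orientations E \<and> (\<forall>A\<in>E. w (k A) = w (h A))} \<subseteq>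
      closed_segment (orientation_vec E h) (orientation_vec E g)"
  proof clarify
    fix k assume k: "k \<in> orientations E" "\<forall>A\<in>E. w (k A) = w (h A)"
    define B where "B = {A \<in> E. k A \<noteq> h A}"
    have kB: "k A = i \<and> h A = j \<and> i \<in> A" if "A \<in> B" for A
    proof -
      have A: "A \<in> E" "k A \<noteq> h A" using that unfolding B_def by auto
      then have arc: "(k A, h A) \<in> arcs E h"
        using arcs_head[OF o(1)] orientation_range[OF k(1)] by blast
      then have "(k A, h A) \<in> S\<^sup>*" unfolding S_def by blast
      moreover from this have "(h A, k A) \<in> S\<^sup>*"
        using down_card_eqD[of "k A" "h A" S n] k(2) A orientation_range[OF o(1)] unfolding w_def by blast
      ultimately have "k A \<in> {i, j}" "h A \<in> {i, j}" using classes A(2) by blast+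
      moreover have "\<not> (k A = j \<and> h A = i)"
        using trancl_into_trancl[OF r_into_trancl[OF arc_ij], of i] arc irrefl by auto
      ultimately show ?thesis using A orientation_range[OF k(1)] by auto
    qed
    define d where "d = unit_vec i - (unit_vec j :: nat \<Rightarrow>\<^sub>0 real)"
    have BD: "B \<subseteq> D" "finite D" "D \<subseteq> E"
      using kB finite_hyperedges unfolding B_def D_def by auto
    have "orientation_vec E k - orientation_vec E h = (\<Sum>A\<in>B. d)"
      unfolding orientation_vec_def d_def sum_subtractf[symmetric]
      using finite_hyperedges kB by (intro sum.mono_neutral_cong_right) (auto simp: B_def)
    then have 1: "orientation_vec E k = orientation_vec E h + real (card B) *\<^sub>R d"
      by (simp add: sum_constant_scaleR algebra_simps del: sum_constant)
    have "orientation_vec E g - orientation_vec E h = (\<Sum>A\<in>D. d)"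
      unfolding orientation_vec_def d_def sum_subtractf[symmetric]
      using finite_hyperedges ij(4) by (intro sum.mono_neutral_cong_right) (auto simp: D_def)
    then have 2: "orientation_vec E g = orientation_vec E h + real (card D) *\<^sub>R d"
      by (simp add: sum_constant_scaleR algebra_simps del: sum_constant)
    have "card D > 0" "card B \<le> card D"
      using \<open>D \<noteq> {}\<close> BD by (auto simp: card_gt_0_iff card_mono)
    \<comment> \<open>The parameter on the segment is the proportion of \<open>D\<close> that has
      been moved.\<close>
    then show "orientation_vec E k \<in> closed_segment (orientation_vec E h) (orientation_vec E g)"
      unfolding in_segment 1 2
      by (intro exI[of _ "real (card B) / real (card D)"]) (simp add: algebra_simps)
  qed
  then have "convex hull {orientation_vec E k | k. k \<in> orientations E \<and> (\<forall>A\<in>E. w (k A) = w (h A))} \<subseteq>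
      closed_segment (orientation_vec E h) (orientation_vec E g)"
    by (rule hull_minimal) simp
  moreover have "\<forall>A\<in>E. w (g A) = w (h A)" using w_ij ij(4) by auto
  then have "closed_segment (orientation_vec E h) (orientation_vec E g) \<subseteq>
      convex hull {orientation_vec E k | k. k \<in> orientations E \<and> (\<forall>A\<in>E. w (k A) = w (h A))}"
    unfolding segment_convex_hull using o by (intro hull_mono) auto
  ultimately show ?thesis
    using maximal_weight_face[of h w, OF o(1) max] by simp
qed

text \<open>A Hamilton path is carried along by a bijection of the vertex sets that maps edges to
  edges.\<close>

lemma hamilton_path_skeleton:
  assumes "hamilton_path (flip_graph n E) hs"
  shows "hamilton_path (skeleton (hypergraphic_polytope E)) (map (indegree_vec n E) hs)"
proof -
  from assms have hs: "distinct hs" "set hs = acyclic_orientations E"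
    and succ: "successively (\<lambda>h k. {h, k} \<in> {{h, h'} | h h'. h \<in> acyclic_orientations E \<and>
      h' \<in> acyclic_orientations E \<and> pair_flip n E h h'}) hs"
    unfolding hamilton_path_def flip_graph_def by auto
  have vec: "map (indegree_vec n E) hs = map (orientation_vec E) hs"
    using hs(2) indegree_vec_eq by (auto simp: acyclic_orientations_def)
  have edge: "\<exists>u v. {orientation_vec E h, orientation_vec E k} = {u, v} \<and> u \<noteq> v \<and>
      closed_segment u v face_of hypergraphic_polytope E"
    if hk: "{h, k} \<in> {{h, h'} | h h'. h \<in> acyclic_orientations E \<and>
      h' \<in> acyclic_orientations E \<and> pair_flip n E h h'}" for h k
  proof -
    from hk obtain h' k' where *: "{h, k} = {h', k'}" "h' \<in> acyclic_orientations E"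
      "k' \<in> acyclic_orientations E" "pair_flip n E h' k'" by blast
    then have "h' \<noteq> k'" unfolding pair_flip_def by blast
    then have "orientation_vec E h' \<noteq> orientation_vec E k'"
      using * inj_on_orientation_vec by (auto dest: inj_onD)
    moreover have "{orientation_vec E h, orientation_vec E k} = {orientation_vec E h', orientation_vec E k'}"
      using *(1) by (auto simp: doubleton_eq_iff)
    ultimately show ?thesis using pair_flip_edge[OF *(2-4)] by blast
  qed
  have "successively (\<lambda>u v. {u, v} \<in> {{u, v} | u v. u \<noteq> v \<and>
      closed_segment u v face_of hypergraphic_polytope E}) (map (orientation_vec E) hs)"
    unfolding successively_map using succ by (rule successively_mono) (use edge in blast)
  then show ?thesis
    unfolding hamilton_path_def skeleton_def vec
    using hs inj_on_orientation_vec extreme_points_hypergraphic_polytope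
    by (simp add: distinct_map)
qed

end


section \<open>Decoding permutations\<close>

lemma position_nth:
  assumes "distinct p" "i < length p"
  shows "position p (p ! i) = Suc i"
  unfolding position_def
proof (rule the_equality)
  fix k assume k: "1 \<le> k \<and> k \<le> length p \<and> p ! (k - 1) = p ! i"
  then have "k - 1 < length p" by linarith
  then have "k - 1 = i" using k assms nth_eq_iff_index_eq[OF assms(1), of "k - 1" i] by blast
  with k show "k = Suc i" by linarith
qed (use assms in auto)

lemma position_mem:
  assumes "distinct p" "v \<in> set p"
  shows "1 \<le> position p v" "position p v \<le> length p" "p ! (position p v - 1) = v"
proof -
  from assms(2) obtain i where "i < length p" "v = p ! i" by (auto simp: in_set_conv_nth)
  with position_nth[OF assms(1)] show "1 \<le> position p v" "position p v \<le> length p"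
    "p ! (position p v - 1) = v" by simp_all
qed

lemma position_inject:
  assumes "distinct p" "u \<in> set p" "v \<in> set p" "position p u = position p v"
  shows "u = v"
  using position_mem(3)[OF assms(1,2)] position_mem(3)[OF assms(1,3)] assms(4) by simp

lemma distinct_ins:
  assumes "distinct p" "Suc (length p) \<notin> set p"
  shows "distinct (ins g p)"
proof -
  have "Suc (length p) \<notin> set (take g p)" "Suc (length p) \<notin> set (drop g p)"
    using assms(2) by (meson in_set_takeD in_set_dropD)+
  with assms(1) set_take_disj_set_drop_if_distinct[OF assms(1), of g g] show ?thesis
    unfolding ins_eq by simp
qed

lemma position_ins:
  assumes "distinct p" "length p = n" "Suc n \<notin> set p" "g \<le> n"
  shows "position (ins g p) (Suc n) = Suc g"
    and "v \<in> set p \<Longrightarrow> position (ins g p) v =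
      (if position p v \<le> g then position p v else Suc (position p v))"
proof -
  have d: "distinct (ins g p)" using distinct_ins assms by blast
  have len: "length (ins g p) = Suc n" using assms by (simp add: ins_eq)
  have "ins g p ! g = Suc n" using assms by (simp add: ins_eq nth_append)
  then show "position (ins g p) (Suc n) = Suc g"
    using position_nth[OF d, of g] len assms(4) by simp
  assume "v \<in> set p"
  then obtain i where i: "i < n" "v = p ! i" using assms(2) by (auto simp: in_set_conv_nth)
  have pos: "position p v = Suc i" using position_nth[OF assms(1)] i assms(2) by simp
  show "position (ins g p) v = (if position p v \<le> g then position p v else Suc (position p v))"
  proof (cases "i < g")
    case True
    then have "ins g p ! i = v" using assms i by (simp add: ins_eq nth_append)
    with position_nth[OF d, of i] len i True pos show ?thesis by auto
  next
    case False
    then have "ins g p ! Suc i = v" using assms i by (simp add: ins_eq nth_append nth_Cons Suc_diff_le)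
    with position_nth[OF d, of "Suc i"] len i False pos show ?thesis by auto
  qed
qed

section \<open>Orienting every hyperedge towards its last letter\<close>

definition last_in :: "nat list \<Rightarrow> nat set \<Rightarrow> nat" where
  "last_in p A = (THE a. a \<in> A \<and> (\<forall>b\<in>A. position p b \<le> position p a))"

lemma last_in_eqI:
  assumes "distinct p" "A \<subseteq> set p" "a \<in> A" "\<And>b. b \<in> A \<Longrightarrow> position p b \<le> position p a"
  shows "last_in p A = a"
  unfolding last_in_def
proof (rule the_equality)
  fix c assume c: "c \<in> A \<and> (\<forall>b\<in>A. position p b \<le> position p c)"
  with assms(3,4) have "position p c = position p a" by (meson antisym)
  with c assms show "c = a" by (meson position_inject subsetD)
qed (use assms in blast)

lemma last_in:
  assumes "distinct p" "A \<subseteq> set p" "A \<noteq> {}"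
  shows "last_in p A \<in> A" and "b \<in> A \<Longrightarrow> position p b \<le> position p (last_in p A)"
proof -
  have fin: "finite (position p ` A)" using assms(2) by (meson finite_imageI finite_set finite_subset)
  then have "Max (position p ` A) \<in> position p ` A" using assms(3) by (intro Max_in) auto
  then obtain a where a: "a \<in> A" "Max (position p ` A) = position p a" by blast
  have max: "position p b \<le> position p a" if "b \<in> A" for b
    using Max_ge[OF fin, of "position p b"] that a(2) by simp
  have eq: "last_in p A = a" using last_in_eqI[OF assms(1,2) a(1) max] .
  show "last_in p A \<in> A" unfolding eq by (rule a(1))
  show "b \<in> A \<Longrightarrow> position p b \<le> position p (last_in p A)" unfolding eq by (rule max)
qed

text \<open>The left inverse of the encoding. It makes sense for every permutation, and the result
  is acyclic because positions increase along arcs.\<close>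

definition decode :: "nat set set \<Rightarrow> nat list \<Rightarrow> nat set \<Rightarrow> nat" where
  "decode E p = (\<lambda>A\<in>E. last_in p A)"

text \<open>Comparing the members of each hyperedge with its head suffices, since these relations
  generate the poset. The inequality is weak only because the head is itself a member.\<close>

definition linear_extension :: "nat \<Rightarrow> nat set set \<Rightarrow> (nat set \<Rightarrow> nat) \<Rightarrow> nat list \<Rightarrow> bool" where
  "linear_extension n E h p \<longleftrightarrow>
     distinct p \<and> set p = {1..n} \<and> (\<forall>A\<in>E. \<forall>a\<in>A. position p a \<le> position p (h A))"

lemma linear_extension_length: "linear_extension n E h p \<Longrightarrow> length p = n"
  using distinct_card[of p] by (auto simp: linear_extension_def)

lemma linear_extension_arc:
  assumes "linear_extension n E h p" "hypergraph n E" "(i, j) \<in> arcs E h"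
  shows "position p i < position p j"
proof -
  from assms(3) obtain A where A: "i \<noteq> j" "A \<in> E" "i \<in> A" "j \<in> A" "j = h A"
    unfolding arcs_def by blast
  moreover have "A \<subseteq> set p"
    using A(2) assms(1,2) by (auto simp: linear_extension_def hypergraph_def)
  ultimately have "i \<in> set p" "j \<in> set p" by blast+
  then have "position p i \<noteq> position p j"
    using position_inject[of p i j] assms(1) A(1) by (auto simp: linear_extension_def)
  moreover have "position p i \<le> position p j"
    using assms(1) A(2,3,5) by (auto simp: linear_extension_def)
  ultimately show ?thesis by simp
qed

lemma linear_extension_trancl:
  assumes "linear_extension n E h p" "hypergraph n E" "(i, j) \<in> (arcs E h)\<^sup>+"
  shows "position p i < position p j"
  using assms(3)
proof induction
  case (step y z)
  with linear_extension_arc[OF assms(1,2) step.hyps(2)] show ?case by simp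
qed (rule linear_extension_arc[OF assms(1,2)])

lemma decode_acyclic_orientation:
  assumes E: "hypergraph n E" and p: "distinct p" "set p = {1..n}"
  shows "decode E p \<in> acyclic_orientations E" "linear_extension n E (decode E p) p"
proof -
  have A: "A \<subseteq> set p" "A \<noteq> {}" if "A \<in> E" for A
    using E that p(2) by (auto simp: hypergraph_def)
  show ext: "linear_extension n E (decode E p) p"
    unfolding linear_extension_def using p last_in(2)[OF p(1) A] by (simp add: decode_def)
  have "decode E p \<in> orientations E"
    unfolding decode_def orientations_def using last_in(1)[OF p(1) A] by simp
  moreover have "acyclic (arcs E (decode E p))"
    unfolding acyclic_def using linear_extension_trancl[OF ext E] by blast
  ultimately show "decode E p \<in> acyclic_orientations E" by (simp add: acyclic_orientations_def)
qed

text \<open>In a linear extension the head of a hyperedge is its last letter, so each linear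
  extension determines the orientation. Injectivity of the encoding comes from here.\<close>

lemma decode_linear_extension:
  assumes E: "hypergraph n E" and h: "h \<in> orientations E" and p: "linear_extension n E h p"
  shows "decode E p = h"
proof
  fix A
  show "decode E p A = h A"
  proof (cases "A \<in> E")
    case True
    then have "A \<subseteq> set p" using E p by (auto simp: hypergraph_def linear_extension_def)
    moreover have "h A \<in> A" using h True by (auto simp: orientations_def)
    ultimately have "last_in p A = h A"
      using p True by (intro last_in_eqI) (auto simp: linear_extension_def)
    with True show ?thesis by (simp add: decode_def)
  next
    case False
    with h show ?thesis by (simp add: decode_def orientations_def PiE_def extensional_def)
  qed
qed

section \<open>Reversing a pair flip\<close>

lemma pair_flip_witness:
  assumes "h \<in> orientations E" "h' = (\<lambda>A\<in>E. if h A = j \<and> i \<in> A then i else h A)" "h' \<noteq> h"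
  obtains X where "X \<in> E" "h X = j" "i \<in> X"
proof -
  have "\<exists>X\<in>E. h X = j \<and> i \<in> X"
  proof (rule ccontr)
    assume none: "\<not> ?thesis"
    have "h' A = h A" for A
    proof (cases "A \<in> E")
      case True
      with none show ?thesis unfolding assms(2) by auto
    next
      case False
      with assms(1) show ?thesis
        unfolding assms(2) by (simp add: orientations_def PiE_def extensional_def)
    qed
    then have "h' = h" by (rule ext)
    with assms(3) show False by (rule notE)
  qed
  with that show thesis by blast
qed

text \<open>Flipping back would also redirect a hyperedge that contains \<open>j\<close> and had
  head \<open>i\<close> from the start. Such a hyperedge gives the arc from \<open>j\<close> to
  \<open>i\<close>, which together with the arc from \<open>i\<close> to \<open>j\<close> of a
  flipped hyperedge is a cycle of \<open>h\<close>.\<close>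

lemma pair_flip_sym:
  assumes h: "acyclic (arcs E h)" and ij: "i \<noteq> j"
    and flip: "h' = (\<lambda>A\<in>E. if h A = j \<and> i \<in> A then i else h A)" "h' \<noteq> h"
    and or: "h \<in> orientations E"
  shows "h = (\<lambda>A\<in>E. if h' A = i \<and> j \<in> A then j else h' A)"
proof -
  obtain X where X: "X \<in> E" "h X = j" "i \<in> X"
    by (rule pair_flip_witness[OF or flip])
  have in_edge: "h A \<in> A" if "A \<in> E" for A using or that by (auto simp: orientations_def)
  have ij_arc: "(i, j) \<in> arcs E h" using X ij in_edge[OF X(1)] unfolding arcs_def by blast
  show ?thesis
  proof
    fix A
    show "h A = (\<lambda>A\<in>E. if h' A = i \<and> j \<in> A then j else h' A) A"
    proof (cases "A \<in> E")
      case True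
      have "\<not> (h A = i \<and> j \<in> A)"
      proof
        assume a: "h A = i \<and> j \<in> A"
        then have "(j, i) \<in> arcs E h" using True ij in_edge[OF True] unfolding arcs_def by blast
        with ij_arc have "(i, i) \<in> (arcs E h)\<^sup>+" by (rule trancl_into_trancl[OF r_into_trancl])
        with h show False unfolding acyclic_def by blast
      qed
      then show ?thesis using True in_edge[OF True] unfolding flip(1) by auto
    qed (use or in \<open>simp add: orientations_def PiE_def extensional_def\<close>)
  qed
qed


section \<open>The extensions of an acyclic orientation by a new vertex\<close>

text \<open>The singleton is excluded because it has no peak and its head is fixed.\<close>

definition top_edges :: "nat \<Rightarrow> nat set set \<Rightarrow> nat set set" where
  "top_edges n E = {A \<in> E. Suc n \<in> A \<and> A \<noteq> {Suc n}}"

text \<open>Read off from the word \<open>p\<close>; that it is the maximum in the poset as well is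
  \<open>peak_arc\<close>, where hyperfectness enters.\<close>

definition peak :: "nat \<Rightarrow> nat list \<Rightarrow> nat set \<Rightarrow> nat" where
  "peak n p A = last_in p (A - {Suc n})"

text \<open>Stands for the chain of distinct peaks, each listed once even if several hyperedges
  share it. Indices start at 0, so index \<open>i\<close> belongs to the first peak whose hyperedges
  do not point to the new vertex.\<close>

definition peak_positions :: "nat \<Rightarrow> nat set set \<Rightarrow> nat list \<Rightarrow> nat list" where
  "peak_positions n E p =
     sorted_list_of_set ((\<lambda>A. position p (peak n p A)) ` top_edges n E)"

text \<open>The number of letters in front of the new letter in the encoding of the extension that orients
  the hyperedges with the first \<open>i\<close> peaks towards the new vertex: the letter goes to one of the two
  ends, or immediately in front of the next peak, which covers it.\<close>

definition gap :: "nat \<Rightarrow> nat set set \<Rightarrow> nat list \<Rightarrow> nat \<Rightarrow> nat" where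
  "gap n E p i = (let xs = peak_positions n E p in
     if i = length xs then n else if i = 0 then 0 else xs ! i - 1)"

text \<open>Decoding a word, instead of prescribing the heads directly, yields acyclicity and a
  linear extension at no cost; the heads are computed afterwards.\<close>

definition extension :: "nat \<Rightarrow> nat set set \<Rightarrow> nat list \<Rightarrow> nat \<Rightarrow> nat set \<Rightarrow> nat" where
  "extension n E p i = decode E (ins (gap n E p i) p)"

lemma hypergraph_induced: "hypergraph (Suc n) E \<Longrightarrow> hypergraph n (induced E n)"
  by (auto simp: hypergraph_def induced_def)

lemma induced_eq: "hypergraph (Suc n) E \<Longrightarrow> induced E n = {A \<in> E. Suc n \<notin> A}"
proof -
  assume "hypergraph (Suc n) E"
  then have "A \<subseteq> {1..Suc n}" if "A \<in> E" for A using that by (auto simp: hypergraph_def)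
  moreover have "{1..Suc n} = insert (Suc n) {1..n}" by auto
  moreover have "Suc n \<notin> {1..n}" by simp
  ultimately have "A \<subseteq> {1..n} \<longleftrightarrow> Suc n \<notin> A" if "A \<in> E" for A
    using that by auto
  then show ?thesis unfolding induced_def by blast
qed

lemma arcsI: "A \<in> E \<Longrightarrow> i \<in> A \<Longrightarrow> j \<in> A \<Longrightarrow> h A = j \<Longrightarrow> i \<noteq> j \<Longrightarrow> (i, j) \<in> arcs E h"
  unfolding arcs_def by blast

lemma arcs_restrict:
  assumes "F \<subseteq> E" "restrict f F = h"
  shows "arcs F h \<subseteq> arcs E f"
  using assms unfolding arcs_def by auto

lemma restrict_acyclic_orientation:
  assumes "f \<in> acyclic_orientations E" "F \<subseteq> E"
  shows "restrict f F \<in> acyclic_orientations F"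
proof -
  have "acyclic (arcs F (restrict f F))"
    using assms(1) acyclic_subset[OF _ arcs_restrict[OF assms(2) refl]]
    by (auto simp: acyclic_orientations_def)
  moreover have "restrict f F \<in> orientations F"
    using assms by (auto simp: acyclic_orientations_def orientations_def)
  ultimately show ?thesis by (simp add: acyclic_orientations_def)
qed

lemma hyperfect_SucD:
  assumes "hyperfect (Suc n) E" "A \<in> E" "B \<in> E" "Suc n \<in> A" "Suc n \<in> B"
    "a \<in> A - {Suc n}" "b \<in> B - {Suc n}" "a \<noteq> b"
  shows "\<exists>X\<in>E. {a, b} \<subseteq> X \<and> X \<subseteq> (A \<union> B) - {Suc n}"
proof -
  have *: "\<forall>A\<in>E. \<forall>B\<in>E. Suc n \<in> A \<inter> B \<longrightarrow>
      (\<forall>a \<in> A - {Suc n}. \<forall>b \<in> B - {Suc n}. a \<noteq> b \<longrightarrow>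
        (\<exists>X\<in>E. {a, b} \<subseteq> X \<and> X \<subseteq> (A \<union> B) - {Suc n}))"
    using assms(1) unfolding hyperfect.simps by (rule conjunct1)
  show ?thesis
    by (rule *[rule_format, OF assms(2,3) IntI[OF assms(4,5)] assms(6-8)])
qed

section \<open>Peaks and gaps over a fixed orientation of the smaller hypergraph\<close>

context
  fixes n :: nat and E :: "nat set set" and h :: "nat set \<Rightarrow> nat" and p :: "nat list"
  assumes E: "hypergraph (Suc n) E"
    and perfect: "hyperfect (Suc n) E"
    and h: "h \<in> acyclic_orientations (induced E n)"
    and p: "linear_extension n (induced E n) h p"
begin

lemma perm: "distinct p" "set p = {1..n}" "length p = n" "Suc n \<notin> set p"
proof -
  show "distinct p" "set p = {1..n}" using p unfolding linear_extension_def by blast+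
  then show "Suc n \<notin> set p" by simp
qed (rule linear_extension_length[OF p])

lemma h_mem: "A \<in> induced E n \<Longrightarrow> h A \<in> A"
  using h PiE_mem[of h "induced E n" "\<lambda>A. A" A]
  unfolding acyclic_orientations_def orientations_def by blast

lemma top_edge:
  assumes "A \<in> top_edges n E"
  shows "A \<in> E" "Suc n \<in> A" "A - {Suc n} \<subseteq> set p" "A - {Suc n} \<noteq> {}"
proof -
  show A: "A \<in> E" "Suc n \<in> A" using assms by (auto simp: top_edges_def)
  then have "A \<subseteq> {1..Suc n}" using E by (auto simp: hypergraph_def)
  then show "A - {Suc n} \<subseteq> set p" unfolding perm(2) by (fastforce simp: le_Suc_eq)
  show "A - {Suc n} \<noteq> {}" using assms by (auto simp: top_edges_def)
qed

lemma peak_mem: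
  assumes "A \<in> top_edges n E"
  shows "peak n p A \<in> A" "peak n p A \<noteq> Suc n" "peak n p A \<in> set p"
  using last_in(1)[OF perm(1) top_edge(3,4)[OF assms]] top_edge(3)[OF assms]
  by (auto simp: peak_def)

lemma peak_max:
  assumes "A \<in> top_edges n E" "b \<in> A" "b \<noteq> Suc n"
  shows "position p b \<le> position p (peak n p A)"
  using last_in(2)[OF perm(1) top_edge(3,4)[OF assms(1)]] assms(2,3) by (simp add: peak_def)

text \<open>A criterion in terms of arcs instead of positions, so that peaks with respect to
  different words can be compared.\<close>

lemma peak_eqI:
  assumes "A \<in> top_edges n E" "c \<in> A" "c \<noteq> Suc n"
    and "\<And>b. b \<in> A \<Longrightarrow> b \<noteq> Suc n \<Longrightarrow> b \<noteq> c \<Longrightarrow> (b, c) \<in> arcs (induced E n) h"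
  shows "peak n p A = c"
  unfolding peak_def
proof (rule last_in_eqI[OF perm(1) top_edge(3)[OF assms(1)]])
  fix b assume "b \<in> A - {Suc n}"
  then show "position p b \<le> position p c"
    using linear_extension_arc[OF p hypergraph_induced[OF E] assms(4), of b]
    by (cases "b = c") auto
qed (use assms(2,3) in simp)

text \<open>Hyperfectness is applied to \<open>A\<close> and \<open>A\<close>. The hyperedge
  \<open>X\<close> contains the peak and lies in \<open>A\<close> without the new vertex; its head
  cannot come before the peak, and nothing of \<open>A\<close> but the new vertex could come after
  it.\<close>

lemma peak_edge:
  assumes A: "A \<in> top_edges n E" and a: "a \<in> A" "a \<noteq> Suc n" "a \<noteq> peak n p A"
  obtains X where "X \<in> induced E n" "X \<subseteq> A" "a \<in> X" "peak n p A \<in> X" "h X = peak n p A"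
proof -
  obtain X where X: "X \<in> E" "{a, peak n p A} \<subseteq> X" "X \<subseteq> (A \<union> A) - {Suc n}"
    using hyperfect_SucD[OF perfect, of A A a "peak n p A"] top_edge[OF A] peak_mem[OF A] a by auto
  then have X': "X \<in> induced E n" unfolding induced_eq[OF E] by auto
  have hX: "h X \<in> A" "h X \<noteq> Suc n" using h_mem[OF X'] X(3) by auto
  have "position p (peak n p A) \<le> position p (h X)"
    using p X' X(2) by (auto simp: linear_extension_def)
  with peak_max[OF A hX] have "position p (h X) = position p (peak n p A)" by simp
  moreover have "h X \<in> set p" using hX top_edge(3)[OF A] by auto
  ultimately have "h X = peak n p A" using position_inject[OF perm(1)] peak_mem(3)[OF A] by blast
  with X X' show thesis by (intro that[of X]) auto
qed

lemma peak_arc: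
  assumes "A \<in> top_edges n E" "a \<in> A" "a \<noteq> Suc n" "a \<noteq> peak n p A"
  shows "(a, peak n p A) \<in> arcs (induced E n) h"
proof -
  obtain X where "X \<in> induced E n" "X \<subseteq> A" "a \<in> X" "peak n p A \<in> X" "h X = peak n p A"
    by (rule peak_edge[OF assms])
  with assms(4) show ?thesis by (intro arcsI[of X]) simp_all
qed

text \<open>Hyperfectness for \<open>A\<close> and \<open>B\<close> gives a hyperedge containing
  both peaks inside the union. Its head comes no earlier than the later peak, so it is not in
  \<open>A\<close>, and within \<open>B\<close> it can only be the peak.\<close>

lemma peak_chain:
  assumes A: "A \<in> top_edges n E" and B: "B \<in> top_edges n E"
    and less: "position p (peak n p A) < position p (peak n p B)"
  shows "(peak n p A, peak n p B) \<in> arcs (induced E n) h"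
proof -
  have ne: "peak n p A \<noteq> peak n p B" using less by auto
  obtain X where X: "X \<in> E" "{peak n p A, peak n p B} \<subseteq> X" "X \<subseteq> (A \<union> B) - {Suc n}"
    using hyperfect_SucD[OF perfect, of A B "peak n p A" "peak n p B"] top_edge[OF A] top_edge[OF B]
      peak_mem[OF A] peak_mem[OF B] ne by auto
  then have X': "X \<in> induced E n" unfolding induced_eq[OF E] by auto
  have le: "position p (peak n p B) \<le> position p (h X)"
    using p X' X(2) by (auto simp: linear_extension_def)
  have N: "h X \<noteq> Suc n" and AB: "h X \<in> A \<or> h X \<in> B" using h_mem[OF X'] X(3) by auto
  have "h X \<notin> A" using peak_max[OF A _ N] le less by auto
  with AB have hB: "h X \<in> B" by blast
  have "position p (h X) = position p (peak n p B)" using peak_max[OF B hB N] le by simp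
  moreover have "h X \<in> set p" using hB N top_edge(3)[OF B] by auto
  ultimately have "h X = peak n p B" using position_inject[OF perm(1)] peak_mem(3)[OF B] by blast
  with X(2) X' ne show ?thesis by (intro arcsI[of X]) simp_all
qed

lemma peak_positions:
  "set (peak_positions n E p) = (\<lambda>A. position p (peak n p A)) ` top_edges n E"
  "sorted_wrt (<) (peak_positions n E p)"
proof -
  have "top_edges n E \<subseteq> Pow {1..Suc n}" using E by (auto simp: hypergraph_def top_edges_def)
  then have "finite (top_edges n E)" by (rule finite_subset) simp
  then show "set (peak_positions n E p) = (\<lambda>A. position p (peak n p A)) ` top_edges n E"
    by (simp add: peak_positions_def)
qed (simp add: peak_positions_def strict_sorted_list_of_set)

lemma peak_position_index:
  assumes "A \<in> top_edges n E"
  obtains j where "j < length (peak_positions n E p)" "position p (peak n p A) = peak_positions n E p ! j"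
proof -
  have "position p (peak n p A) \<in> set (peak_positions n E p)"
    unfolding peak_positions(1) using assms by (rule imageI)
  then show thesis using that unfolding in_set_conv_nth by metis
qed

lemma peak_position_edge:
  assumes "j < length (peak_positions n E p)"
  obtains A where "A \<in> top_edges n E" "position p (peak n p A) = peak_positions n E p ! j"
proof -
  have "peak_positions n E p ! j \<in> (\<lambda>A. position p (peak n p A)) ` top_edges n E"
    using nth_mem[OF assms] peak_positions(1) by simp
  then show thesis using that by auto
qed

lemma peak_positions_less_iff:
  assumes "i < length (peak_positions n E p)" "j < length (peak_positions n E p)"
  shows "peak_positions n E p ! i < peak_positions n E p ! j \<longleftrightarrow> i < j"
  using sorted_wrt_nth_less[OF peak_positions(2), of i j] sorted_wrt_nth_less[OF peak_positions(2), of j i]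
    assms by (cases i j rule: linorder_cases) auto

lemma peak_positions_bounds:
  assumes "j < length (peak_positions n E p)"
  shows "1 \<le> peak_positions n E p ! j" "peak_positions n E p ! j \<le> n"
proof -
  obtain A where A: "A \<in> top_edges n E" "position p (peak n p A) = peak_positions n E p ! j"
    using peak_position_edge[OF assms] .
  show "1 \<le> peak_positions n E p ! j" "peak_positions n E p ! j \<le> n"
    using position_mem(1,2)[OF perm(1) peak_mem(3)[OF A(1)]] A(2) perm(3) by simp_all
qed

text \<open>Translates between the index of an extension and its word: with
  \<open>gap n E p i\<close> letters in front of the new one, exactly the peaks of index below
  \<open>i\<close> precede it. In the intermediate case the gap is one less than the position of
  peak \<open>i\<close>, so the new letter lands immediately in front of that peak.\<close>

lemma gap_threshold:
  assumes "j < length (peak_positions n E p)" "i \<le> length (peak_positions n E p)"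
  shows "peak_positions n E p ! j \<le> gap n E p i \<longleftrightarrow> j < i"
proof -
  consider "i = length (peak_positions n E p)" | "i = 0" "i \<noteq> length (peak_positions n E p)"
    | "0 < i" "i < length (peak_positions n E p)" using assms(2) by linarith
  then show ?thesis
  proof cases
    case 3
    then show ?thesis
      using peak_positions_less_iff[OF assms(1) 3(2)] peak_positions_bounds[OF 3(2)]
      by (auto simp: gap_def Let_def)
  qed (use assms peak_positions_bounds[OF assms(1)] in \<open>auto simp: gap_def Let_def\<close>)
qed

lemma gap_le: "i \<le> length (peak_positions n E p) \<Longrightarrow> gap n E p i \<le> n"
  using peak_positions_bounds(2)[of i] by (auto simp: gap_def Let_def)

lemma gap_less:
  assumes "i < j" "j \<le> length (peak_positions n E p)"
  shows "gap n E p i < gap n E p j"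
proof -
  have "\<not> peak_positions n E p ! i \<le> gap n E p i" "peak_positions n E p ! i \<le> gap n E p j"
    using gap_threshold[of i i] gap_threshold[of i j] assms by simp_all
  then show ?thesis by linarith
qed

section \<open>Heads, completeness and encodings of the extensions\<close>

lemma extension_acyclic:
  assumes "i \<le> length (peak_positions n E p)"
  shows "extension n E p i \<in> acyclic_orientations E"
    and "linear_extension (Suc n) E (extension n E p i) (ins (gap n E p i) p)"
proof -
  have d: "distinct (ins (gap n E p i) p)" using distinct_ins[of p] perm by simp
  have s: "set (ins (gap n E p i) p) = {1..Suc n}" using perm by (auto simp: set_ins)
  show "extension n E p i \<in> acyclic_orientations E"
    "linear_extension (Suc n) E (extension n E p i) (ins (gap n E p i) p)"
    unfolding extension_def using decode_acyclic_orientation[OF E d s] by simp_all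
qed

lemma extension_old: "A \<in> induced E n \<Longrightarrow> i \<le> length (peak_positions n E p) \<Longrightarrow> extension n E p i A = h A"
proof -
  assume A: "A \<in> induced E n" and i: "i \<le> length (peak_positions n E p)"
  have sub: "A \<in> E" "A \<subseteq> set p" using A perm(2) by (auto simp: induced_def)
  note pos = position_ins(2)[OF perm(1,3,4) gap_le[OF i]]
  have "last_in (ins (gap n E p i) p) A = h A"
  proof (rule last_in_eqI)
    fix b assume b: "b \<in> A"
    then have "position p b \<le> position p (h A)" using p A by (auto simp: linear_extension_def)
    then show "position (ins (gap n E p i) p) b \<le> position (ins (gap n E p i) p) (h A)"
      using pos[OF subsetD[OF sub(2) b]] pos[OF subsetD[OF sub(2) h_mem[OF A]]] by simp
  qed (use sub distinct_ins[of p] perm h_mem[OF A] in \<open>auto simp: set_ins\<close>)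
  with sub(1) show ?thesis by (simp add: extension_def decode_def)
qed

lemma extension_singleton:
  assumes "{Suc n} \<in> E"
  shows "extension n E p i {Suc n} = Suc n"
proof -
  have "last_in (ins (gap n E p i) p) {Suc n} = Suc n"
    using perm distinct_ins[of p] by (intro last_in_eqI) (auto simp: set_ins)
  with assms show ?thesis by (simp add: extension_def decode_def)
qed

lemma extension_top:
  assumes A: "A \<in> top_edges n E" and i: "i \<le> length (peak_positions n E p)"
  shows "extension n E p i A = (if position p (peak n p A) \<le> gap n E p i then Suc n else peak n p A)"
proof -
  let ?q = "ins (gap n E p i) p"
  note pos = position_ins[OF perm(1,3,4) gap_le[OF i]]
  have q: "distinct ?q" "A \<subseteq> set ?q"
    using distinct_ins[of p] perm top_edge(3)[OF A] by (auto simp: set_ins)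
  have "last_in ?q A = (if position p (peak n p A) \<le> gap n E p i then Suc n else peak n p A)"
  proof (rule last_in_eqI[OF q])
    fix b assume b: "b \<in> A"
    show "position ?q b \<le> position ?q
        (if position p (peak n p A) \<le> gap n E p i then Suc n else peak n p A)"
    proof (cases "b = Suc n")
      case True
      then show ?thesis using pos(1) pos(2)[OF peak_mem(3)[OF A]] by auto
    next
      case False
      then have "b \<in> set p" using b top_edge(3)[OF A] by auto
      with peak_max[OF A b False] pos(1) pos(2)[of b] pos(2)[OF peak_mem(3)[OF A]]
      show ?thesis by auto
    qed
  qed (use top_edge(2)[OF A] peak_mem(1)[OF A] in auto)
  with top_edge(1)[OF A] show ?thesis by (simp add: extension_def decode_def)
qed

lemma hyperedge_cases:
  assumes "A \<in> E"
  obtains "A \<in> induced E n" "Suc n \<notin> A" | "A = {Suc n}" | "A \<in> top_edges n E"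
proof -
  have "A \<in> induced E n \<and> Suc n \<notin> A \<or> A = {Suc n} \<or> A \<in> top_edges n E"
    using assms unfolding induced_eq[OF E] top_edges_def by auto
  then show thesis using that by blast
qed

lemma extension_restrict:
  assumes "i \<le> length (peak_positions n E p)"
  shows "restrict (extension n E p i) (induced E n) = h"
proof
  fix A
  show "restrict (extension n E p i) (induced E n) A = h A"
    using extension_old[OF _ assms, of A] h
    by (cases "A \<in> induced E n")
      (auto simp: acyclic_orientations_def orientations_def PiE_def extensional_def)
qed

text \<open>Acyclicity leaves two possible heads for a hyperedge at the new vertex, and the peaks
  whose hyperedges point to the new vertex are closed downwards in the chain. The index is then the
  first peak where this stops.\<close>

lemma extension_exhaust:
  assumes f: "f \<in> acyclic_orientations E" "restrict f (induced E n) = h"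
  obtains i where "i \<le> length (peak_positions n E p)" "f = extension n E p i"
proof -
  let ?xs = "peak_positions n E p"
  have irrefl: "(x, x) \<notin> (arcs E f)\<^sup>+" for x
    using f(1) by (auto simp: acyclic_orientations_def acyclic_def)
  have f_mem: "f A \<in> A" if "A \<in> E" for A
    using f(1) that by (auto simp: acyclic_orientations_def orientations_def)
  have sub: "arcs (induced E n) h \<subseteq> arcs E f"
    using f(2) by (intro arcs_restrict) (auto simp: induced_def)
  \<comment> \<open>Any other head would form a 2-cycle with the peak: the smaller hypergraph has an
    arc from it to the peak, and \<open>A\<close> gives the arc back.\<close>
  have two: "f A = Suc n \<or> f A = peak n p A" if A: "A \<in> top_edges n E" for A
  proof (rule ccontr)
    assume ne: "\<not> ?thesis"
    have AE: "A \<in> E" using top_edge(1)[OF A] .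
    have "(f A, peak n p A) \<in> arcs E f" using peak_arc[OF A f_mem[OF AE]] ne sub by blast
    moreover have "(peak n p A, f A) \<in> arcs E f"
      using AE peak_mem(1)[OF A] f_mem[OF AE] ne by (intro arcsI[of A]) auto
    ultimately have "(f A, f A) \<in> (arcs E f)\<^sup>+" by (rule trancl_into_trancl[OF r_into_trancl])
    with irrefl show False by blast
  qed
  \<comment> \<open>Otherwise there is a cycle from the new vertex to the peak of \<open>B\<close>,
    up the chain to the peak of \<open>A\<close> (possibly the same vertex), and back.\<close>
  have down: "f B = Suc n"
    if A: "A \<in> top_edges n E" and B: "B \<in> top_edges n E" and fA: "f A = Suc n"
      and le: "position p (peak n p B) \<le> position p (peak n p A)" for A B
  proof (rule ccontr)
    assume "f B \<noteq> Suc n"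
    then have fB: "f B = peak n p B" using two[OF B] by blast
    have 1: "(Suc n, peak n p B) \<in> arcs E f"
      using top_edge(1,2)[OF B] peak_mem(1,2)[OF B] fB by (intro arcsI[of B]) simp_all
    have 2: "(peak n p A, Suc n) \<in> arcs E f"
      using top_edge(1,2)[OF A] peak_mem(1,2)[OF A] fA by (intro arcsI[of A]) simp_all
    have "peak n p B = peak n p A \<or> (peak n p B, peak n p A) \<in> arcs E f"
    proof (cases "position p (peak n p B) = position p (peak n p A)")
      case True
      then show ?thesis using position_inject[OF perm(1) peak_mem(3)[OF B] peak_mem(3)[OF A]] by blast
    next
      case False
      then show ?thesis using peak_chain[OF B A] le sub by auto
    qed
    then have "(Suc n, peak n p A) \<in> (arcs E f)\<^sup>+"
    proof
      assume "(peak n p B, peak n p A) \<in> arcs E f"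
      then show ?thesis by (rule trancl_into_trancl[OF r_into_trancl[OF 1]])
    qed (use 1 in auto)
    then have "(Suc n, Suc n) \<in> (arcs E f)\<^sup>+" using 2 by (rule trancl_into_trancl)
    with irrefl show False by blast
  qed
  define P where "P = (\<lambda>i. i = length ?xs \<or>
    (\<exists>B\<in>top_edges n E. position p (peak n p B) = ?xs ! i \<and> f B \<noteq> Suc n))"
  define i where "i = (LEAST i. P i)"
  have "P (length ?xs)" by (simp add: P_def)
  then have i: "P i" "i \<le> length ?xs" and least: "\<And>j. j < i \<Longrightarrow> \<not> P j"
    unfolding i_def by (auto intro: LeastI Least_le dest: not_less_Least)
  have top: "f A = extension n E p i A" if A: "A \<in> top_edges n E" for A
  proof -
    obtain j where j: "j < length ?xs" "position p (peak n p A) = ?xs ! j"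
      using peak_position_index[OF A] .
    show ?thesis
    proof (cases "j < i")
      case True
      then have "f A = Suc n" using least[OF True] A j unfolding P_def by blast
      with True extension_top[OF A i(2)] gap_threshold[OF j(1) i(2)] j(2) show ?thesis by simp
    next
      case False
      then have "i < length ?xs" using j(1) by simp
      with i(1) obtain B where B: "B \<in> top_edges n E" "position p (peak n p B) = ?xs ! i" "f B \<noteq> Suc n"
        unfolding P_def by blast
      have "?xs ! i \<le> ?xs ! j"
        using peak_positions_less_iff[OF j(1) \<open>i < length ?xs\<close>] False by simp
      then have "f A \<noteq> Suc n" using down[OF A B(1)] B(2,3) j(2) by auto
      then have "f A = peak n p A" using two[OF A] by blast
      with False extension_top[OF A i(2)] gap_threshold[OF j(1) i(2)] j(2) show ?thesis by simp
    qed
  qed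
  have "f = extension n E p i"
  proof
    fix A
    show "f A = extension n E p i A"
    proof (cases "A \<in> E")
      case True
      then show ?thesis
      proof (cases rule: hyperedge_cases)
        case 1
        then show ?thesis using extension_old[OF 1(1) i(2)] f(2) by auto
      next
        case 2
        then show ?thesis using True extension_singleton f_mem[OF True] by auto
      qed (rule top)
    next
      case False
      then show ?thesis
        using f(1) extension_acyclic(1)[OF i(2)]
        by (simp add: acyclic_orientations_def orientations_def PiE_def extensional_def)
    qed
  qed
  with i(2) show thesis by (rule that)
qed

text \<open>The three cases of \<open>encode\<close> correspond to those of \<open>gap\<close>. If
  there are no peaks, the index is both 0 and the length and the new vertex is both minimal and
  maximal; both definitions then test for the right end first.\<close>

lemma encode_extension:
  assumes i: "i \<le> length (peak_positions n E p)" and enc: "encode n (induced E n) h = p"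
  shows "encode (Suc n) E (extension n E p i) = ins (gap n E p i) p"
proof -
  let ?xs = "peak_positions n E p" and ?f = "extension n E p i" and ?g = "gap n E p i"
  have encode: "encode (Suc n) E ?f =
    (if \<nexists>j. precedes E ?f (Suc n) j then insert_max (Suc n) p
      else if \<nexists>j. precedes E ?f j (Suc n) then insert_max 1 p
      else insert_max (position p (THE j. covered_by E ?f (Suc n) j)) p)"
    by (simp only: encode.simps Let_def extension_restrict[OF i] enc)
  note acyc = extension_acyclic[OF i]
  note pos = position_ins[OF perm(1,3,4) gap_le[OF i]]
  have less: "position (ins ?g p) x < position (ins ?g p) y" if "precedes E ?f x y" for x y
    using linear_extension_trancl[OF acyc(2) E] that unfolding precedes_def .
  have f_N: "A \<in> top_edges n E" if "A \<in> E" "Suc n \<in> A" "a \<in> A" "a \<noteq> Suc n" for A a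
    using that by (auto simp: top_edges_def)
  have out: "\<exists>A\<in>top_edges n E. y = peak n p A \<and> \<not> position p (peak n p A) \<le> ?g"
    if "(Suc n, y) \<in> arcs E ?f" for y
  proof -
    from that obtain A where A: "A \<in> E" "Suc n \<in> A" "y \<in> A" "y \<noteq> Suc n" "y = ?f A"
      unfolding arcs_def by auto
    then have "A \<in> top_edges n E" using f_N by blast
    with A extension_top[OF this i] show ?thesis by (auto split: if_splits)
  qed
  show ?thesis
  proof (cases "i = length ?xs")
    case True
    then have g: "?g = n" by (simp add: gap_def Let_def)
    have "\<not> precedes E ?f (Suc n) j" for j
    proof
      assume "precedes E ?f (Suc n) j"
      then obtain y where "(Suc n, y) \<in> arcs E ?f" unfolding precedes_def by (blast dest: tranclD)
      then obtain A where "A \<in> top_edges n E" "\<not> position p (peak n p A) \<le> ?g" using out by blast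
      with position_mem(2)[OF perm(1) peak_mem(3)] g perm(3) show False by simp
    qed
    then show ?thesis unfolding encode g by simp
  next
    case False
    then have i': "i < length ?xs" using i by simp
    obtain B where B: "B \<in> top_edges n E" "position p (peak n p B) = ?xs ! i"
      using peak_position_edge[OF i'] .
    have gB: "\<not> position p (peak n p B) \<le> ?g" using gap_threshold[OF i' i] B(2) by simp
    then have fB: "?f B = peak n p B" using extension_top[OF B(1) i] by simp
    have NB: "(Suc n, peak n p B) \<in> arcs E ?f"
      using top_edge(1,2)[OF B(1)] peak_mem(1,2)[OF B(1)] fB by (intro arcsI[of B]) simp_all
    show ?thesis
    proof (cases "i = 0")
      case True
      then have g: "?g = 0" using False by (simp add: gap_def Let_def)
      have "\<not> precedes E ?f j (Suc n)" for j
      proof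
        assume "precedes E ?f j (Suc n)"
        then obtain y where "(y, Suc n) \<in> arcs E ?f" unfolding precedes_def by (blast dest: tranclD2)
        then obtain A where A: "A \<in> E" "Suc n \<in> A" "y \<in> A" "y \<noteq> Suc n" "?f A = Suc n"
          unfolding arcs_def by auto
        then have top: "A \<in> top_edges n E" using f_N by blast
        then have "position p (peak n p A) \<le> 0"
          using extension_top[OF top i] A(5) peak_mem(2)[OF top] g by (auto split: if_splits)
        with position_mem(1)[OF perm(1) peak_mem(3)[OF top]] show False by simp
      qed
      moreover have "\<exists>j. precedes E ?f (Suc n) j" using NB unfolding precedes_def by blast
      ultimately show ?thesis unfolding encode g by simp
    next
      case i0: False
      have g: "Suc ?g = ?xs ! i"
        using False i0 peak_positions_bounds(1)[OF i'] by (simp add: gap_def Let_def)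
      have len: "0 < length ?xs" using i' by linarith
      obtain C where C: "C \<in> top_edges n E" "position p (peak n p C) = ?xs ! 0"
        using peak_position_edge[OF len] .
      have fC: "?f C = Suc n" using extension_top[OF C(1) i] gap_threshold[OF len i] C(2) i0 by simp
      have CN: "(peak n p C, Suc n) \<in> arcs E ?f"
        using fC top_edge(1,2)[OF C(1)] peak_mem(1,2)[OF C(1)] by (intro arcsI[of C]) simp_all
      \<comment> \<open>The cover is the peak of index \<open>i\<close>. It stands immediately
        behind the new letter in a linear extension, so nothing fits in between. Conversely, every
        path leaving the new vertex first reaches a peak of index at least \<open>i\<close>, which
        is this one or above it in the chain.\<close>
      have "(THE j. covered_by E ?f (Suc n) j) = peak n p B"
      proof (rule the_equality)
        show "covered_by E ?f (Suc n) (peak n p B)"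
          unfolding covered_by_def
        proof (intro conjI notI)
          show "precedes E ?f (Suc n) (peak n p B)" using NB unfolding precedes_def by blast
          assume "\<exists>k. precedes E ?f (Suc n) k \<and> precedes E ?f k (peak n p B)"
          then obtain k where k: "precedes E ?f (Suc n) k" "precedes E ?f k (peak n p B)" by blast
          have "position (ins ?g p) (peak n p B) = Suc (Suc ?g)"
            using pos(2)[OF peak_mem(3)[OF B(1)]] gB B(2) g by simp
          with less[OF k(1)] less[OF k(2)] pos(1) show False by simp
        qed
      next
        fix y assume y: "covered_by E ?f (Suc n) y"
        then have no: "\<And>k. (Suc n, k) \<in> (arcs E ?f)\<^sup>+ \<Longrightarrow> (k, y) \<notin> (arcs E ?f)\<^sup>+"
          and Ny: "(Suc n, y) \<in> (arcs E ?f)\<^sup>+"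
          unfolding covered_by_def precedes_def by auto
        obtain z where z: "(Suc n, z) \<in> arcs E ?f" "(z, y) \<in> (arcs E ?f)\<^sup>*"
          using tranclD[OF Ny] by blast
        from out[OF z(1)] obtain A where A: "A \<in> top_edges n E" "z = peak n p A"
          "\<not> position p (peak n p A) \<le> ?g" by blast
        show "y = peak n p B"
        proof (cases "z = peak n p B")
          case True
          have "(z, y) \<notin> (arcs E ?f)\<^sup>+" by (rule no[OF r_into_trancl[OF z(1)]])
          then show ?thesis using rtranclD[OF z(2)] True by blast
        next
          case False
          have "position p z \<noteq> position p (peak n p B)"
            using position_inject[OF perm(1) peak_mem(3)[OF A(1)] peak_mem(3)[OF B(1)]] False A(2) by blast
          then have "position p (peak n p B) < position p (peak n p A)" using A(2,3) B(2) g by simp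
          then have "(peak n p B, z) \<in> arcs (induced E n) h" unfolding A(2) by (rule peak_chain[OF B(1) A(1)])
          then have "(peak n p B, z) \<in> arcs E ?f"
            using arcs_restrict[OF _ extension_restrict[OF i]] by (auto simp: induced_def)
          then have "(peak n p B, y) \<in> (arcs E ?f)\<^sup>+" using z(2) by (rule rtrancl_into_trancl2)
          with no[OF r_into_trancl[OF NB]] show ?thesis by blast
        qed
      qed
      moreover have "\<exists>j. precedes E ?f (Suc n) j" "\<exists>j. precedes E ?f j (Suc n)"
        using NB CN unfolding precedes_def by blast+
      moreover have "position p (peak n p B) = Suc ?g" using B(2) g by simp
      ultimately show ?thesis unfolding encode by simp
    qed
  qed
qed

text \<open>The flipped pair consists of the new vertex and the peak of index \<open>i\<close>.
  Older hyperedges with this head do not contain the new vertex, so exactly the hyperedges with that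
  peak are redirected.\<close>

lemma extension_flip:
  assumes i: "i < length (peak_positions n E p)"
  shows "pair_flip (Suc n) E (extension n E p i) (extension n E p (Suc i))"
proof -
  let ?xs = "peak_positions n E p" and ?f = "extension n E p i" and ?f' = "extension n E p (Suc i)"
  have le: "i \<le> length ?xs" "Suc i \<le> length ?xs" using i by simp_all
  obtain B where B: "B \<in> top_edges n E" "position p (peak n p B) = ?xs ! i"
    using peak_position_edge[OF i] .
  have BE: "B \<in> E" "peak n p B \<in> {1..Suc n}" "peak n p B \<noteq> Suc n"
    using top_edge(1)[OF B(1)] peak_mem[OF B(1)] perm(2) by auto
  have fB: "?f B = peak n p B" "?f' B = Suc n"
    using extension_top[OF B(1) le(1)] extension_top[OF B(1) le(2)]
      gap_threshold[OF i le(1)] gap_threshold[OF i le(2)] B(2) by simp_all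
  have "?f' = (\<lambda>A\<in>E. if ?f A = peak n p B \<and> Suc n \<in> A then Suc n else ?f A)"
  proof
    fix A
    show "?f' A = (\<lambda>A\<in>E. if ?f A = peak n p B \<and> Suc n \<in> A then Suc n else ?f A) A"
    proof (cases "A \<in> E")
      case True
      then show ?thesis
      proof (cases rule: hyperedge_cases)
        case 1
        then show ?thesis using True extension_old[OF 1(1)] le by simp
      next
        case 2
        then show ?thesis using True extension_singleton by simp
      next
        case 3
        obtain j where j: "j < length ?xs" "position p (peak n p A) = ?xs ! j"
          using peak_position_index[OF 3] .
        have f: "?f A = (if j < i then Suc n else peak n p A)"
          "?f' A = (if j < Suc i then Suc n else peak n p A)"
          using extension_top[OF 3 le(1)] extension_top[OF 3 le(2)]
            gap_threshold[OF j(1) le(1)] gap_threshold[OF j(1) le(2)] j(2) by simp_all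
        have "peak n p A = peak n p B \<longleftrightarrow> j = i"
        proof
          assume "peak n p A = peak n p B"
          then have "?xs ! j = ?xs ! i" using j(2) B(2) by simp
          then show "j = i"
            using peak_positions_less_iff[OF i j(1)] peak_positions_less_iff[OF j(1) i] by simp
        next
          assume "j = i"
          then show "peak n p A = peak n p B"
            using position_inject[OF perm(1) peak_mem(3)[OF 3] peak_mem(3)[OF B(1)]] j(2) B(2) by simp
        qed
        with f True top_edge(2)[OF 3] BE(3) show ?thesis by auto
      qed
    next
      case False
      then show ?thesis
        using extension_acyclic(1)[OF le(2)]
        by (simp add: acyclic_orientations_def orientations_def PiE_def extensional_def)
    qed
  qed
  moreover have "?f' \<noteq> ?f" using fB BE(3) by auto
  ultimately show ?thesis
    unfolding pair_flip_def using BE by (intro conjI bexI[of _ "Suc n"] bexI[of _ "peak n p B"]) auto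
qed

lemma extension_last:
  assumes "A \<in> E"
  shows "extension n E p (length (peak_positions n E p)) A = (if Suc n \<in> A then Suc n else h A)"
  using assms
proof (cases rule: hyperedge_cases)
  case 1
  then show ?thesis using extension_old[OF 1(1)] by auto
next
  case 2
  then show ?thesis using extension_singleton assms by simp
next
  case 3
  have "gap n E p (length (peak_positions n E p)) = n" by (simp add: gap_def Let_def)
  with extension_top[OF 3 order_refl] top_edge(2)[OF 3]
    position_mem(2)[OF perm(1) peak_mem(3)[OF 3]] perm(3) show ?thesis by simp
qed

lemma extension_first:
  assumes "A \<in> E"
  shows "extension n E p 0 A =
    (if A = {Suc n} then Suc n else if Suc n \<in> A then peak n p A else h A)"
  using assms
proof (cases rule: hyperedge_cases)
  case 1
  then show ?thesis using extension_old[OF 1(1)] by auto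
next
  case 2
  then show ?thesis using extension_singleton assms by simp
next
  case 3
  obtain j where j: "j < length (peak_positions n E p)"
    "position p (peak n p A) = peak_positions n E p ! j"
    using peak_position_index[OF 3] .
  have "A \<noteq> {Suc n}" using 3 by (auto simp: top_edges_def)
  with extension_top[OF 3, of 0] top_edge(2)[OF 3] gap_threshold[OF j(1), of 0] j(2)
  show ?thesis by simp
qed

end


section \<open>Lifting a pair flip at the two ends of a sweep\<close>

context
  fixes n :: nat and E :: "nat set set"
  assumes E: "hypergraph (Suc n) E" and perfect: "hyperfect (Suc n) E"
begin

text \<open>Each arc into the peak comes from a hyperedge \<open>X\<close> inside \<open>A\<close>
  with the peak as head. If the peak is \<open>j\<close>, then \<open>i\<close> is missing from
  \<open>A\<close> and hence from \<open>X\<close>, so the flip leaves \<open>X\<close> alone in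
  every case.\<close>

lemma peak_flip_keep:
  assumes h: "h \<in> acyclic_orientations (induced E n)" and p: "linear_extension n (induced E n) h p"
    and h': "h' \<in> acyclic_orientations (induced E n)" and p': "linear_extension n (induced E n) h' p'"
    and flip: "h' = (\<lambda>A\<in>induced E n. if h A = j \<and> i \<in> A then i else h A)"
    and A: "A \<in> top_edges n E" and keep: "\<not> (peak n p A = j \<and> i \<in> A)"
  shows "peak n p' A = peak n p A"
proof (rule peak_eqI[OF E perfect h' p' A])
  show "peak n p A \<in> A" "peak n p A \<noteq> Suc n"
    by (rule peak_mem[OF E perfect h p A])+
  fix b assume b: "b \<in> A" "b \<noteq> Suc n" "b \<noteq> peak n p A"
  obtain X where X: "X \<in> induced E n" "X \<subseteq> A" "b \<in> X" "peak n p A \<in> X" "h X = peak n p A"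
    by (rule peak_edge[OF E perfect h p A b])
  have "h' X = peak n p A" using flip X keep by auto
  with X b show "(b, peak n p A) \<in> arcs (induced E n) h'" by (intro arcsI[of X]) simp_all
qed

text \<open>Peaks change like heads. If a peak \<open>j\<close> did not move to \<open>i\<close>,
  the reverse flip would keep the new peak, which would then be \<open>j\<close>; but after the flip
  \<open>j\<close> precedes \<open>i\<close>, and \<open>i\<close> lies in \<open>A\<close>.\<close>

lemma peak_flip:
  assumes h: "h \<in> acyclic_orientations (induced E n)" and p: "linear_extension n (induced E n) h p"
    and h': "h' \<in> acyclic_orientations (induced E n)" and p': "linear_extension n (induced E n) h' p'"
    and flip: "h' = (\<lambda>A\<in>induced E n. if h A = j \<and> i \<in> A then i else h A)" "h' \<noteq> h"
    and ij: "i \<noteq> j" "i \<noteq> Suc n"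
    and A: "A \<in> top_edges n E"
  shows "peak n p' A = (if peak n p A = j \<and> i \<in> A then i else peak n p A)"
proof (cases "peak n p A = j \<and> i \<in> A")
  case True
  have o: "h \<in> orientations (induced E n)" "acyclic (arcs (induced E n) h)"
    using h by (auto simp: acyclic_orientations_def)
  obtain X where X: "X \<in> induced E n" "h X = j" "i \<in> X"
    by (rule pair_flip_witness[OF o(1) flip])
  have "j \<in> X" using o(1) X(1,2) by (auto simp: orientations_def)
  then have "(j, i) \<in> arcs (induced E n) h'" using X flip(1) ij(1) by (intro arcsI[of X]) simp_all
  then have less: "position p' j < position p' i"
    by (rule linear_extension_arc[OF p' hypergraph_induced[OF E]])
  have "peak n p' A = i"
  proof (rule ccontr)
    assume ne: "peak n p' A \<noteq> i"
    then have "\<not> (peak n p' A = i \<and> j \<in> A)" by blast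
    then have "peak n p A = peak n p' A"
      by (rule peak_flip_keep[OF h' p' h p pair_flip_sym[OF o(2) ij(1) flip o(1)] A])
    then have "position p' i \<le> position p' j"
      using peak_max[OF E perfect h' p' A _ ij(2)] True by simp
    with less show False by simp
  qed
  with True show ?thesis by simp
next
  case False
  show ?thesis unfolding if_not_P[OF False] by (rule peak_flip_keep[OF h p h' p' flip(1) A False])
qed

text \<open>The same pair is flipped upstairs. At the right end the hyperedges containing the new
  vertex all point to it and are unaffected; at the left end they point to their peaks (apart from
  the singleton), which \<open>peak_flip\<close> handles.\<close>

lemma extension_flip_ends:
  assumes h: "h \<in> acyclic_orientations (induced E n)" and p: "linear_extension n (induced E n) h p"
    and h': "h' \<in> acyclic_orientations (induced E n)" and p': "linear_extension n (induced E n) h' p'"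
    and flip: "pair_flip n (induced E n) h h'"
  shows "pair_flip (Suc n) E (extension n E p 0) (extension n E p' 0)"
    and "pair_flip (Suc n) E (extension n E p (length (peak_positions n E p)))
      (extension n E p' (length (peak_positions n E p')))"
proof -
  note C = E perfect h p
  note C' = E perfect h' p'
  from flip obtain i j where ij: "i \<in> {1..n}" "j \<in> {1..n}" "i \<noteq> j"
    and eq: "h' = (\<lambda>A\<in>induced E n. if h A = j \<and> i \<in> A then i else h A)" and ne: "h' \<noteq> h"
    unfolding pair_flip_def by blast
  have N: "i \<noteq> Suc n" "j \<noteq> Suc n" using ij by auto
  have dom: "extension n E p' k A = undefined"
    if "A \<notin> E" "k \<le> length (peak_positions n E p')" for A k
    using extension_acyclic(1)[OF C' that(2)] that(1)
    by (simp add: acyclic_orientations_def orientations_def PiE_def extensional_def)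
  have ext_ne: "extension n E p' k' \<noteq> extension n E p k"
    if "k \<le> length (peak_positions n E p)" "k' \<le> length (peak_positions n E p')" for k k'
    using extension_restrict[OF C that(1)] extension_restrict[OF C' that(2)] ne by metis
  have flipI: "pair_flip (Suc n) E (extension n E p k) (extension n E p' k')"
    if "k \<le> length (peak_positions n E p)" "k' \<le> length (peak_positions n E p')"
      "\<And>A. A \<in> E \<Longrightarrow> extension n E p' k' A =
        (if extension n E p k A = j \<and> i \<in> A then i else extension n E p k A)" for k k'
  proof -
    have "extension n E p' k' =
        (\<lambda>A\<in>E. if extension n E p k A = j \<and> i \<in> A then i else extension n E p k A)"
    proof
      fix A
      show "extension n E p' k' A =
        (\<lambda>A\<in>E. if extension n E p k A = j \<and> i \<in> A then i else extension n E p k A) A"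
        using that(3)[of A] dom[OF _ that(2), of A] by (cases "A \<in> E") simp_all
    qed
    moreover have "i \<in> {1..Suc n}" "j \<in> {1..Suc n}" using ij by simp_all
    ultimately show ?thesis
      unfolding pair_flip_def using ij(3) ext_ne[OF that(1,2)] by blast
  qed
  have old: "h' A = (if h A = j \<and> i \<in> A then i else h A)" if "A \<in> E" "Suc n \<notin> A" for A
    using that unfolding eq induced_eq[OF E] by simp
  show "pair_flip (Suc n) E (extension n E p 0) (extension n E p' 0)"
  proof (rule flipI)
    fix A assume A: "A \<in> E"
    show "extension n E p' 0 A =
        (if extension n E p 0 A = j \<and> i \<in> A then i else extension n E p 0 A)"
    proof (cases "A = {Suc n} \<or> Suc n \<notin> A")
      case True
      then show ?thesis
        unfolding extension_first[OF C A] extension_first[OF C' A] using old[OF A] N by auto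
    next
      case False
      then have top: "A \<in> top_edges n E" using A by (simp add: top_edges_def)
      show ?thesis
        unfolding extension_first[OF C A] extension_first[OF C' A]
          peak_flip[OF h p h' p' eq ne ij(3) N(1) top] using False by simp
    qed
  qed simp_all
  show "pair_flip (Suc n) E (extension n E p (length (peak_positions n E p)))
      (extension n E p' (length (peak_positions n E p')))"
  proof (rule flipI)
    fix A assume A: "A \<in> E"
    show "extension n E p' (length (peak_positions n E p')) A =
        (if extension n E p (length (peak_positions n E p)) A = j \<and> i \<in> A then i
         else extension n E p (length (peak_positions n E p)) A)"
      unfolding extension_last[OF C A] extension_last[OF C' A] using old[OF A] N by auto
  qed simp_all
qed

end


section \<open>The Hamilton path\<close>

lemma hd_map_upt: "hd (map f [0..<Suc k]) = f 0"
  by (simp add: upt_conv_Cons del: upt_Suc)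

lemma last_map_upt: "last (map f [0..<Suc k]) = f k"
  by simp

lemma successively_map_upt:
  "(\<And>i. i < k \<Longrightarrow> R (f i) (f (Suc i))) \<Longrightarrow> successively R (map f [0..<Suc k])"
  by (simp add: successively_conv_nth nth_append del: upt_Suc)

lemma sorted_wrt_map_upt:
  "(\<And>i j. i < j \<Longrightarrow> j \<le> k \<Longrightarrow> f i < f j) \<Longrightarrow> sorted_wrt (<) (map f [0..<Suc k])"
  by (simp add: sorted_wrt_iff_nth_less del: upt_Suc)

text \<open>The symmetric form of a flip, as needed for sweeps run backwards; it matches the
  undirected edges of the flip graph.\<close>

definition flip_adjacent ::
  "nat \<Rightarrow> nat set set \<Rightarrow> (nat set \<Rightarrow> nat) \<Rightarrow> (nat set \<Rightarrow> nat) \<Rightarrow> bool" where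
  "flip_adjacent n E h h' \<longleftrightarrow> pair_flip n E h h' \<or> pair_flip n E h' h"

text \<open>An acyclic orientation is one of the extensions of its restriction, and its encoding is
  the word from which that extension was decoded.\<close>

lemma linear_extension_encode:
  assumes "hypergraph n E" "hyperfect n E" "h \<in> acyclic_orientations E"
  shows "linear_extension n E h (encode n E h)"
  using assms
proof (induction n arbitrary: E h)
  case 0
  then have "E \<subseteq> {}" unfolding hypergraph_def by auto
  then show ?case by (simp add: linear_extension_def)
next
  case (Suc n)
  define h' p where "h' = restrict h (induced E n)" and "p = encode n (induced E n) h'"
  have h': "h' \<in> acyclic_orientations (induced E n)"
    unfolding h'_def by (rule restrict_acyclic_orientation[OF Suc.prems(3)]) (auto simp: induced_def)
  have p: "linear_extension n (induced E n) h' p"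
    unfolding p_def
    by (rule Suc.IH[OF hypergraph_induced[OF Suc.prems(1)] _ h']) (use Suc.prems(2) in simp)
  note C = Suc.prems(1) Suc.prems(2) h' p
  obtain i where i: "i \<le> length (peak_positions n E p)" "h = extension n E p i"
    by (rule extension_exhaust[OF C Suc.prems(3) h'_def[symmetric]])
  have "encode (Suc n) E h = ins (gap n E p i) p"
    unfolding i(2) by (rule encode_extension[OF C i(1) p_def[symmetric]])
  then show ?case using extension_acyclic(2)[OF C i(1)] i(2) by simp
qed

lemma inj_on_encode:
  assumes "hypergraph n E" "hyperfect n E"
  shows "inj_on (encode n E) (acyclic_orientations E)"
proof (rule inj_on_inverseI)
  fix h assume h: "h \<in> acyclic_orientations E"
  then have "h \<in> orientations E" by (simp add: acyclic_orientations_def)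
  then show "decode E (encode n E h) = h"
    by (rule decode_linear_extension[OF assms(1) _ linear_extension_encode[OF assms h]])
qed

lemma Hamilton_sequence:
  assumes "hypergraph n E" "hyperfect n E"
  shows "\<exists>hs. hs \<noteq> [] \<and> distinct hs \<and> set hs = acyclic_orientations E \<and>
    successively (flip_adjacent n E) hs \<and> encode n E (hd hs) = id_perm n \<and>
    J_run (encodings n E) (map (encode n E) hs)"
  using assms
proof (induction n arbitrary: E)
  case 0
  then have E: "E = {}" unfolding hypergraph_def by auto
  have AO: "acyclic_orientations E = {\<lambda>_. undefined}"
    unfolding acyclic_orientations_def orientations_def arcs_def E by (auto simp: acyclic_def)
  have "\<not> J_step {[]} [[]] q" for q
    unfolding J_step_def J_candidate_def by auto
  then have "J_run {[]} [[]]"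
    unfolding J_run_def by (auto simp: Cons_eq_append_conv)
  then show ?case
    by (intro exI[of _ "[\<lambda>_. undefined]"]) (simp add: AO id_perm_def encodings_def)
next
  case (Suc n)
  define E' where "E' = induced E n"
  define enc where "enc = encode n E'"
  note E = Suc.prems(1)
  note perfect = Suc.prems(2)
  have E': "hypergraph n E'" "hyperfect n E'" "E' \<subseteq> E"
    using hypergraph_induced[OF E] Suc.prems(2) unfolding E'_def by (auto simp: induced_def)
  obtain hs where hs: "hs \<noteq> []" "distinct hs" "set hs = acyclic_orientations E'"
    "successively (flip_adjacent n E') hs" "enc (hd hs) = id_perm n"
    "J_run (encodings n E') (map enc hs)"
    using Suc.IH[OF E'(1,2)] unfolding enc_def by blast
  have lin: "linear_extension n E' h (enc h)" if "h \<in> acyclic_orientations E'" for h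
    unfolding enc_def by (rule linear_extension_encode[OF E'(1,2) that])
  define H where "H = (\<lambda>h. extension n E (enc h))"
  define k where "k = (\<lambda>h. length (peak_positions n E (enc h)))"
  define f where "f = (\<lambda>h. map (H h) [0..<Suc (k h)])"
  define G where "G = (\<lambda>h. map (gap n E (enc h)) [0..<Suc (k h)])"
  \<comment> \<open>The first block is reversed, so that the new letter starts at the right end, as
    in the identity.\<close>
  define ks where "ks = zigzag True f hs"
  have C: "h \<in> acyclic_orientations (induced E n)" "linear_extension n (induced E n) h (enc h)"
    if "h \<in> acyclic_orientations E'" for h
    using that lin[OF that] by (simp_all add: E'_def)
  have H: "H h i \<in> acyclic_orientations E" "restrict (H h i) E' = h"
    "encode (Suc n) E (H h i) = ins (gap n E (enc h) i) (enc h)"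
    if h: "h \<in> acyclic_orientations E'" and i: "i \<le> k h" for h i
  proof -
    note i' = i[unfolded k_def]
    show "H h i \<in> acyclic_orientations E"
      unfolding H_def by (rule extension_acyclic(1)[OF E perfect C[OF h] i'])
    show "restrict (H h i) E' = h"
      unfolding H_def E'_def by (rule extension_restrict[OF E perfect C[OF h] i'])
    show "encode (Suc n) E (H h i) = ins (gap n E (enc h) i) (enc h)"
      unfolding H_def
      by (rule encode_extension[OF E perfect C[OF h] i']) (simp add: enc_def E'_def)
  qed
  \<comment> \<open>The blocks are the fibres of the restriction map, which makes them disjoint and
    exhaustive.\<close>
  have set_f: "set (f h) = {g \<in> acyclic_orientations E. restrict g E' = h}"
    if h: "h \<in> acyclic_orientations E'" for h
  proof
    show "set (f h) \<subseteq> {g \<in> acyclic_orientations E. restrict g E' = h}"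
      using H(1,2)[OF h] by (auto simp: f_def simp del: upt_Suc)
    show "{g \<in> acyclic_orientations E. restrict g E' = h} \<subseteq> set (f h)"
    proof
      fix g assume "g \<in> {g \<in> acyclic_orientations E. restrict g E' = h}"
      then have g: "g \<in> acyclic_orientations E" "restrict g (induced E n) = h"
        by (simp_all add: E'_def)
      obtain i where "i \<le> length (peak_positions n E (enc h))" "g = extension n E (enc h) i"
        by (rule extension_exhaust[OF E perfect C[OF h] g])
      then show "g \<in> set (f h)" by (simp add: f_def H_def k_def del: upt_Suc)
    qed
  qed
  have set_ks: "set ks = acyclic_orientations E"
  proof -
    have "set ks = (\<Union>h\<in>acyclic_orientations E'. {g \<in> acyclic_orientations E. restrict g E' = h})"
      unfolding ks_def set_zigzag hs(3) using set_f by simp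
    also have "\<dots> = acyclic_orientations E"
      using restrict_acyclic_orientation[OF _ E'(3)] by auto
    finally show ?thesis .
  qed
  have gap_less': "gap n E (enc h) i < gap n E (enc h) j"
    if "h \<in> acyclic_orientations E'" "i < j" "j \<le> k h" for h i j
    using gap_less[OF E perfect C[OF that(1)] that(2)] that(3) unfolding k_def .
  have map_f: "map (encode (Suc n) E) (f h) = map (\<lambda>g. ins g (enc h)) (G h)"
    if h: "h \<in> acyclic_orientations E'" for h
    using H(3)[OF h] by (simp add: f_def G_def del: upt_Suc)
  have enc_perm: "length (enc h) = n" "set (enc h) = {1..n}" if "h \<in> acyclic_orientations E'" for h
    using linear_extension_length[OF lin[OF that]] lin[OF that] by (simp_all add: linear_extension_def)
  have G_sorted: "sorted_wrt (<) (G h)" if "h \<in> acyclic_orientations E'" for h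
    unfolding G_def by (rule sorted_wrt_map_upt) (rule gap_less'[OF that])
  have G_last: "last (G h) = n" for h
    unfolding G_def last_map_upt by (simp add: gap_def k_def)
  \<comment> \<open>Whether there is any peak depends on the hypergraph alone and not on
    \<open>h\<close>; this supplies the uniform alternative for the first gaps in
    \<open>J_run_zigzag\<close>.\<close>
  have k_iff: "k h = 0 \<longleftrightarrow> top_edges n E = {}" if h: "h \<in> acyclic_orientations E'" for h
    unfolding k_def
    using peak_positions(1)[OF E perfect C[OF h]] by (metis image_is_empty length_0_conv set_empty)
  have G_hd: "hd (G h) = (if top_edges n E = {} then n else 0)"
    if h: "h \<in> acyclic_orientations E'" for h
    using k_iff[OF h] unfolding G_def hd_map_upt by (simp add: gap_def k_def Let_def)
  have distinct_f: "distinct (f h)" if h: "h \<in> acyclic_orientations E'" for h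
  proof -
    have "distinct (G h)" using G_sorted[OF h] by (simp add: strict_sorted_iff)
    moreover have "inj_on (\<lambda>g. ins g (enc h)) (set (G h))"
    proof (rule inj_onI)
      fix g g' assume g: "g \<in> set (G h)" "g' \<in> set (G h)" "ins g (enc h) = ins g' (enc h)"
      have le: "x \<le> n" if "x \<in> set (G h)" for x
        using that gap_le[OF E perfect C[OF h]] by (auto simp: G_def k_def simp del: upt_Suc)
      show "g = g'"
        using ins_inject[of "enc h" n "enc h" g g'] enc_perm[OF h] le g by simp
    qed
    ultimately have "distinct (map (encode (Suc n) E) (f h))"
      unfolding map_f[OF h] by (simp add: distinct_map)
    then show ?thesis by (simp add: distinct_map)
  qed
  have "distinct ks"
    unfolding ks_def
  proof (rule distinct_zigzag[OF hs(2)])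
    fix h h' assume "h \<in> set hs" "h' \<in> set hs" "h \<noteq> h'"
    then show "set (f h) \<inter> set (f h') = {}" using set_f hs(3) by auto
  qed (use distinct_f hs(3) in blast)
  moreover have "successively (flip_adjacent (Suc n) E) ks"
    unfolding ks_def
  proof (rule successively_zigzag)
    fix h assume "h \<in> set hs"
    then have h: "h \<in> acyclic_orientations E'" using hs(3) by simp
    have "successively (flip_adjacent (Suc n) E) (f h)"
      unfolding f_def
    proof (rule successively_map_upt)
      fix i assume "i < k h"
      then have "pair_flip (Suc n) E (H h i) (H h (Suc i))"
        unfolding H_def k_def by (rule extension_flip[OF E perfect C[OF h]])
      then show "flip_adjacent (Suc n) E (H h i) (H h (Suc i))" by (simp add: flip_adjacent_def)
    qed
    then show "f h \<noteq> [] \<and> successively (flip_adjacent (Suc n) E) (f h)" by (simp add: f_def)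
  next
    have ends: "flip_adjacent (Suc n) E (hd (f h)) (hd (f h')) \<and>
        flip_adjacent (Suc n) E (last (f h)) (last (f h'))"
      if h: "h \<in> set hs" "h' \<in> set hs" "flip_adjacent n E' h h'" for h h'
    proof -
      have hh: "h \<in> acyclic_orientations E'" "h' \<in> acyclic_orientations E'" using h hs(3) by simp_all
      have step: "pair_flip (Suc n) E (H g 0) (H g' 0) \<and> pair_flip (Suc n) E (H g (k g)) (H g' (k g'))"
        if "g \<in> acyclic_orientations E'" "g' \<in> acyclic_orientations E'" "pair_flip n E' g g'" for g g'
        using extension_flip_ends[OF E Suc.prems(2) C[OF that(1)] C[OF that(2)]
            that(3)[unfolded E'_def]]
        unfolding H_def k_def by blast
      show ?thesis
        using h(3) step[OF hh] step[OF hh(2,1)]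
        unfolding f_def hd_map_upt last_map_upt flip_adjacent_def by blast
    qed
    show "successively (\<lambda>x y. flip_adjacent (Suc n) E (hd (f x)) (hd (f y)) \<and>
        flip_adjacent (Suc n) E (last (f x)) (last (f y))) hs"
      by (rule successively_mono[OF hs(4) ends])
  qed (auto simp: flip_adjacent_def)
  moreover have map_ks: "map (encode (Suc n) E) ks = zigzag True (\<lambda>h. map (\<lambda>g. ins g (enc h)) (G h)) hs"
    unfolding ks_def map_zigzag by (rule zigzag_cong) (use map_f hs(3) in blast)
  have run: "J_run (encodings (Suc n) E) (map (encode (Suc n) E) ks)"
  proof -
    have "encodings (Suc n) E = set (map (encode (Suc n) E) ks)"
      by (simp add: encodings_def set_ks)
    also have "\<dots> = (\<Union>h\<in>set hs. (\<lambda>g. ins g (enc h)) ` set (G h))"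
      unfolding map_ks by simp
    finally have L: "encodings (Suc n) E = \<dots>" .
    show ?thesis
      unfolding L map_ks
    proof (rule J_run_zigzag)
      show "J_run (enc ` set hs) (map enc hs)" using hs(3,6) by (simp add: encodings_def enc_def)
      show "inj_on enc (set hs)" unfolding enc_def hs(3) by (rule inj_on_encode[OF E'(1,2)])
      show "(\<forall>h\<in>set hs. hd (G h) = 0) \<or> (\<forall>h\<in>set hs. hd (G h) = n)"
        using G_hd hs(3) by (cases "top_edges n E = {}") auto
      show "distinct hs" by (rule hs(2))
      fix h assume "h \<in> set hs"
      then have h: "h \<in> acyclic_orientations E'" using hs(3) by simp
      show "length (enc h) = n \<and> set (enc h) \<subseteq> {1..n}" using enc_perm[OF h] by simp
      show "G h \<noteq> [] \<and> sorted_wrt (<) (G h) \<and> last (G h) = n"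
        using G_sorted[OF h] G_last by (simp add: G_def)
    qed
  qed
  obtain h0 hs' where hs0: "hs = h0 # hs'" using hs(1) by (cases hs) auto
  then have h0: "h0 \<in> acyclic_orientations E'" using hs(3) by auto
  have "ks \<noteq> []" "hd ks = H h0 (k h0)"
    unfolding ks_def hs0 by (simp_all add: f_def hd_append hd_rev)
  moreover have "encode (Suc n) E (H h0 (k h0)) = id_perm (Suc n)"
  proof -
    have "gap n E (enc h0) (k h0) = n" by (simp add: gap_def k_def Let_def)
    then have "encode (Suc n) E (H h0 (k h0)) = enc h0 @ [Suc n]"
      using H(3)[OF h0 order_refl] ins_length[of "enc h0"] enc_perm(1)[OF h0] by simp
    also have "enc h0 = id_perm n" using hs(5) hs0 by simp
    finally show ?thesis by (simp add: id_perm_def)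
  qed
  ultimately show ?case using set_ks run by (intro exI[of _ ks]) (simp del: encode.simps)
qed

theorem theorem15:
  fixes n :: nat and E :: "nat set set"
  assumes "hypergraph n E" and "hyperfect n E"
  shows "\<exists>hs. set hs \<subseteq> acyclic_orientations E \<and>
           (\<forall>ps. J_output (encodings n E) (id_perm n) ps \<longleftrightarrow> ps = map (encode n E) hs) \<and>
           hamilton_path (flip_graph n E) hs \<and>
           hamilton_path (skeleton (hypergraphic_polytope E)) (map (indegree_vec n E) hs)"
proof -
  obtain hs where hs: "hs \<noteq> []" "distinct hs" "set hs = acyclic_orientations E"
    "successively (flip_adjacent n E) hs" "encode n E (hd hs) = id_perm n"
    "J_run (encodings n E) (map (encode n E) hs)"
    using Hamilton_sequence[OF assms] by blast
  have path: "hamilton_path (flip_graph n E) hs"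
  proof -
    have "{h, k} \<in> {{h, h'} | h h'. h \<in> acyclic_orientations E \<and> h' \<in> acyclic_orientations E \<and>
        pair_flip n E h h'}"
      if hk: "h \<in> set hs" "k \<in> set hs" "flip_adjacent n E h k" for h k
      using hk hs(3) unfolding flip_adjacent_def by (auto simp: insert_commute)
    then have "successively (\<lambda>h k. {h, k} \<in> {{h, h'} | h h'. h \<in> acyclic_orientations E \<and>
        h' \<in> acyclic_orientations E \<and> pair_flip n E h h'}) hs"
      by (rule successively_mono[OF hs(4)])
    then show ?thesis
      unfolding hamilton_path_def flip_graph_def using hs(2,3) by simp
  qed
  have "map (encode n E) hs = id_perm n # map (encode n E) (tl hs)"
    using hs(1,5) by (cases hs) auto
  then have "\<forall>ps. J_output (encodings n E) (id_perm n) ps \<longleftrightarrow> ps = map (encode n E) hs"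
    using J_output_iff_run hs(6) by metis
  with path hamilton_path_skeleton[OF assms(1) path] hs(3) show ?thesis by blast
qed

end
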